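(* Let $\Omega\subset\mathbb{R}^N$ be an open set, let $\Omega_0\subset\subset\Omega$ be a compactly embedded open subset, and let $\psi\in W^{1,\infty}_{loc}(\Omega,\mathbb{R})$ be such that $|\nabla\psi(x)|=1$ for a.e. $x\in\Omega$. Let $\eta\in C_c^\infty(\mathbb{R}^N,\mathbb{R})$ be a nonnegative function with $\operatorname{supp}\eta\subset\overline{B_1(0)}$ and $\int_{\mathbb{R}^N}\eta(z)\,dz=1$. For $x\in\Omega$ and $0<\varepsilon<\operatorname{dist}(x,\partial\Omega)$ define $$\psi_\varepsilon(x):=\frac1{\varepsilon^N}\int_{\mathbb{R}^N}\eta\Big(\frac{y-x}{\varepsilon}\Big)\psi(y)\,dy=\int_{\mathbb{R}^N}\eta(z)\psi(x+\varepsilon z)\,dz .$$ Assume in addition that $\nabla\psi\in BV^q_{loc}(\Omega,\mathbb{R}^N)\cap BV^p_{loc}(\Omega,\mathbb{R}^N)$ for some $q>1$ and $p\ge2$. Then $$\limsup_{\varepsilon\to0^+}\int_{\Omega_0}\bigg(\varepsilon^{q-1}|\nabla^2\psi_\varepsilon(x)|^q+\frac1\varepsilon\big(1-|\nabla\psi_\varepsilon(x)|^2\big)^{\frac p2}\bigg)dx\le$$ $$\bigg(\int_{\mathbb{R}^N}|z|^{\frac1{q-1}}|\nabla\eta(z)|^{\frac q{q-1}}dz\bigg)^{q-1}A_{\nabla\psi,q}(\overline\Omega_0)+\bigg(\int_{\mathbb{R}^N}|z|^{\frac2{p-2}}|\eta(z)|^{\frac p{p-2}}dz\bigg)^{\frac{p-2}2}A_{\nabla\psi,p}(\overline\Omega_0).$$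 In particular, if $\nabla\psi\in BV^3_{loc}(\Omega,\mathbb{R}^N)$ then $$\frac{3}{\sqrt[3]{4}}\limsup_{\varepsilon\to0^+}\int_{\Omega_0}|\nabla^2\psi_\varepsilon(x)|\,\Big|1-|\nabla\psi_\varepsilon(x)|^2\Big|\,dx\le\limsup_{\varepsilon\to0^+}\bigg(\int_{\Omega_0}\varepsilon^2|\nabla^2\psi_\varepsilon(x)|^3dx+\int_{\Omega_0}\frac1\varepsilon\big(1-|\nabla\psi_\varepsilon(x)|^2\big)^{\frac32}dx\bigg)$$ $$\le D_\eta A_{\nabla\psi,3}(\overline\Omega_0)=D_\eta\limsup_{\varepsilon\to0^+}\int_{B_1(0)}\int_{\Omega_0}\frac1{\varepsilon|z|}\big|\nabla\psi(x+\varepsilon z)-\nabla\psi(x)\big|^3dx\,dz,$$ where $$D_\eta:=\bigg(\int_{\mathbb{R}^N}|z|^{\frac12}|\nabla\eta(z)|^{\frac32}dz\bigg)^2+\bigg(\int_{\mathbb{R}^N}|z|^2|\eta(z)|^3dz\bigg)^{\frac12}.$$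
   Context: $\Omega_0\subset\subset\Omega$ means that $\overline\Omega_0$ is a compact subset of $\Omega$. For $r\ge1$, an open set $U$ and $v\in L^r_{loc}(U,\mathbb{R}^d)$, let $\bar A_{v,r}(U):=\sup_{\varepsilon\in(0,1)}\int_U\int_{B_\varepsilon(x)\cap U}\frac1{\varepsilon^N}\frac{|v(y)-v(x)|^r}{|y-x|}\,dy\,dx$; $BV^r(U,\mathbb{R}^d)$ is the set of $v\in L^r(U,\mathbb{R}^d)$ with $\bar A_{v,r}(U)<\infty$, and $v\in BV^r_{loc}(\Omega,\mathbb{R}^d)$ means $v\in BV^r(\Omega',\mathbb{R}^d)$ for every open $\Omega'\subset\subset\Omega$. For $r\geq 1$, $$A_{\nabla\psi,r}(\overline\Omega_0):=\limsup_{\varepsilon\to0^+}\int_{\overline\Omega_0}\int_{B_\varepsilon(x)}\frac1{\varepsilon^N}\frac{|\nabla\psi(y)-\nabla\psi(x)|^r}{|y-x|}\,dy\,dx .$$ $|\nabla^2\psi_\varepsilon|$ is the Euclidean (Frobenius) norm of the Hessian. When $p=2$, the factor $\big(\int_{\mathbb{R}^N}|z|^{\frac2{p-2}}|\eta(z)|^{\frac p{p-2}}dz\big)^{\frac{p-2}2}$ is understood as $\sup_{z\in\mathbb{R}^N}|z|\,|\eta(z)|$.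
   Formalization: The last equality is false if ∂Ω₀ has positive measure. It is proved with closure(Ω₀) in place of Ω₀ on the right, and as printed when ∂Ω₀ is a null set; the upper bound by D_η times the printed right-hand limsup over Ω₀ is proved for all Ω₀. *)

theory Defs
  imports "HOL-Analysis.Analysis"
begin

text \<open>
  Functions that the mathematics defines only on an open set \<open>U\<close> are total here; every
  notion below inspects their values on \<open>U\<close> only, or nearly so (see \<open>A_lim\<close> and \<open>mollify\<close>).
  All integrals are with respect to the (complete) Lebesgue measure.
\<close>

definition compactly_in :: "(real^'n) set \<Rightarrow> (real^'n) set \<Rightarrow> bool" where
  "compactly_in U \<Omega> \<longleftrightarrow> compact (closure U) \<and> closure U \<subseteq> \<Omega>"


subsection \<open>Classical derivatives\<close>

definition partial :: "'n \<Rightarrow> (real^'n \<Rightarrow> real) \<Rightarrow> real^'n \<Rightarrow> real" where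
  "partial i f x = frechet_derivative f (at x) (axis i 1)"

definition grad :: "(real^'n \<Rightarrow> real) \<Rightarrow> real^'n \<Rightarrow> real^'n" where
  "grad f x = (\<chi> i. partial i f x)"

text \<open>The library norm of a matrix in \<open>real^'n^'n\<close> is its Euclidean (Frobenius) norm.\<close>

definition hessian :: "(real^'n \<Rightarrow> real) \<Rightarrow> real^'n \<Rightarrow> real^'n^'n" where
  "hessian f x = jacobian (grad f) (at x)"

primrec C_k :: "nat \<Rightarrow> (real^'n \<Rightarrow> real) \<Rightarrow> bool" where
  "C_k 0 f \<longleftrightarrow> continuous_on UNIV f"
| "C_k (Suc k) f \<longleftrightarrow> (\<forall>x. f differentiable (at x)) \<and> (\<forall>i. C_k k (partial i f))"

definition smooth :: "(real^'n \<Rightarrow> real) \<Rightarrow> bool" where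
  "smooth f \<longleftrightarrow> (\<forall>k. C_k k f)"

definition supp :: "(real^'n \<Rightarrow> real) \<Rightarrow> (real^'n) set" where
  "supp f = closure {x. f x \<noteq> 0}"

text \<open>\<open>Cc_inf U\<close>: the elements of \<open>C\<^sub>c\<^sup>\<infinity>(U)\<close>, extended by zero.\<close>

definition Cc_inf :: "(real^'n) set \<Rightarrow> (real^'n \<Rightarrow> real) set" where
  "Cc_inf U = {f. smooth f \<and> compact (supp f) \<and> supp f \<subseteq> U}"


subsection \<open>Lebesgue and Sobolev spaces\<close>

definition L1_loc :: "(real^'n) set \<Rightarrow> (real^'n \<Rightarrow> 'b::euclidean_space) \<Rightarrow> bool" where
  "L1_loc \<Omega> f \<longleftrightarrow> (\<forall>K. compact K \<and> K \<subseteq> \<Omega> \<longrightarrow> f absolutely_integrable_on K)"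

definition L_pow :: "real \<Rightarrow> (real^'n) set \<Rightarrow> (real^'n \<Rightarrow> 'b::euclidean_space) \<Rightarrow> bool" where
  "L_pow r U f \<longleftrightarrow> f \<in> borel_measurable (lebesgue_on U) \<and>
     (\<integral>\<^sup>+x\<in>U. ennreal (norm (f x) powr r) \<partial>lebesgue) < \<infinity>"

definition L_inf :: "(real^'n) set \<Rightarrow> (real^'n \<Rightarrow> 'b::euclidean_space) \<Rightarrow> bool" where
  "L_inf U f \<longleftrightarrow> f \<in> borel_measurable (lebesgue_on U) \<and>
     (\<exists>C. AE x in lebesgue_on U. norm (f x) \<le> C)"

definition weak_gradient :: "(real^'n) set \<Rightarrow> (real^'n \<Rightarrow> real) \<Rightarrow> (real^'n \<Rightarrow> real^'n) \<Rightarrow> bool" where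
  "weak_gradient \<Omega> f g \<longleftrightarrow> L1_loc \<Omega> f \<and> L1_loc \<Omega> g \<and>
     (\<forall>\<phi>\<in>Cc_inf \<Omega>. \<forall>i. (LINT x:\<Omega>|lebesgue. f x * partial i \<phi> x)
                       = - (LINT x:\<Omega>|lebesgue. g x $ i * \<phi> x))"

definition W1_inf :: "(real^'n) set \<Rightarrow> (real^'n \<Rightarrow> real) \<Rightarrow> bool" where
  "W1_inf U f \<longleftrightarrow> L_inf U f \<and> (\<exists>g. weak_gradient U f g \<and> L_inf U g)"

definition W1_inf_loc :: "(real^'n) set \<Rightarrow> (real^'n \<Rightarrow> real) \<Rightarrow> bool" where
  "W1_inf_loc \<Omega> f \<longleftrightarrow> (\<forall>U. open U \<and> compactly_in U \<Omega> \<longrightarrow> W1_inf U f)"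


subsection \<open>The spaces BV^r\<close>

text \<open>At \<open>y = x\<close> the quotient is \<open>0 / 0 = 0\<close>; this affects a null set only.\<close>

definition A_bar :: "real \<Rightarrow> (real^'n \<Rightarrow> real^'n) \<Rightarrow> (real^'n) set \<Rightarrow> ennreal" where
  "A_bar r v U = (SUP \<epsilon>\<in>{0<..<1}. \<integral>\<^sup>+x\<in>U. (\<integral>\<^sup>+y\<in>ball x \<epsilon> \<inter> U.
     ennreal (1 / \<epsilon> ^ CARD('n) * (norm (v y - v x) powr r / norm (y - x))) \<partial>lebesgue) \<partial>lebesgue)"

definition BV :: "real \<Rightarrow> (real^'n) set \<Rightarrow> (real^'n \<Rightarrow> real^'n) \<Rightarrow> bool" where
  "BV r U v \<longleftrightarrow> L_pow r U v \<and> A_bar r v U < \<infinity>"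

definition BV_loc :: "real \<Rightarrow> (real^'n) set \<Rightarrow> (real^'n \<Rightarrow> real^'n) \<Rightarrow> bool" where
  "BV_loc r \<Omega> v \<longleftrightarrow> (\<forall>U. open U \<and> compactly_in U \<Omega> \<longrightarrow> BV r U v)"

text \<open>
  The inner ball is not intersected with the ambient open set; for \<open>K\<close> compact in that set
  the balls lie inside it as soon as \<open>\<epsilon>\<close> is small, so the limes superior ignores values outside.
\<close>

definition A_lim :: "real \<Rightarrow> (real^'n \<Rightarrow> real^'n) \<Rightarrow> (real^'n) set \<Rightarrow> ennreal" where
  "A_lim r v K = Limsup (at_right 0) (\<lambda>\<epsilon>. \<integral>\<^sup>+x\<in>K. (\<integral>\<^sup>+y\<in>ball x \<epsilon>.
     ennreal (1 / \<epsilon> ^ CARD('n) * (norm (v y - v x) powr r / norm (y - x))) \<partial>lebesgue) \<partial>lebesgue)"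


subsection \<open>Mollification and the constants\<close>

text \<open>
  Meaningful for \<open>0 < \<epsilon> < dist(x, \<partial>\<Omega>)\<close>: if \<open>\<eta>\<close> is supported in the closed unit ball, only
  values of \<open>\<psi>\<close> on the closed ball of radius \<open>\<epsilon>\<close> about \<open>x\<close> matter.
\<close>

definition mollify :: "(real^'n \<Rightarrow> real) \<Rightarrow> (real^'n \<Rightarrow> real) \<Rightarrow> real \<Rightarrow> real^'n \<Rightarrow> real" where
  "mollify \<eta> \<psi> \<epsilon> x = 1 / \<epsilon> ^ CARD('n) * (LINT y|lebesgue. \<eta> ((1 / \<epsilon>) *\<^sub>R (y - x)) * \<psi> y)"

definition hessian_const :: "(real^'n \<Rightarrow> real) \<Rightarrow> real \<Rightarrow> real" where
  "hessian_const \<eta> q =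
     (LINT z|lebesgue. norm z powr (1 / (q - 1)) * norm (grad \<eta> z) powr (q / (q - 1))) powr (q - 1)"

text \<open>For \<open>p = 2\<close> the exponents degenerate and the supremum is the limiting value.\<close>

definition defect_const :: "(real^'n \<Rightarrow> real) \<Rightarrow> real \<Rightarrow> real" where
  "defect_const \<eta> p = (if p = 2 then (SUP z. norm z * \<bar>\<eta> z\<bar>)
     else (LINT z|lebesgue. norm z powr (2 / (p - 2)) * \<bar>\<eta> z\<bar> powr (p / (p - 2))) powr ((p - 2) / 2))"

definition D_const :: "(real^'n \<Rightarrow> real) \<Rightarrow> real" where
  "D_const \<eta> =
     (LINT z|lebesgue. norm z powr (1 / 2) * norm (grad \<eta> z) powr (3 / 2)) ^ 2
     + (LINT z|lebesgue. norm z ^ 2 * \<bar>\<eta> z\<bar> ^ 3) powr (1 / 2)"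

text \<open>\<open>A_lim 3 v S\<close> after the substitution \<open>y = x + \<epsilon> z\<close> and an exchange of the integrals.\<close>

definition A3_shift :: "(real^'n \<Rightarrow> real^'n) \<Rightarrow> (real^'n) set \<Rightarrow> ennreal" where
  "A3_shift v S = Limsup (at_right 0) (\<lambda>\<epsilon>. \<integral>\<^sup>+z\<in>ball 0 1. (\<integral>\<^sup>+x\<in>S.
     ennreal (1 / (\<epsilon> * norm z) * norm (v (x + \<epsilon> *\<^sub>R z) - v x) ^ 3) \<partial>lebesgue) \<partial>lebesgue)"

end

theory Submission
  imports Defs
begin

text \<open>
  For small \<open>\<epsilon>\<close>, both integrands are controlled at each point by the inner integral of the functional
  \<open>A_lim\<close>, with exponents \<open>q\<close> and \<open>p\<close>. Write \<open>g\<close> for the weak gradient of \<open>\<psi>\<close> and \<open>\<Delta>(z)\<close> for the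
  increment \<open>g (x + \<epsilon> z) - g x\<close>.

  Differentiating the kernel shows that \<open>grad \<psi>\<^sub>\<epsilon>\<close> at \<open>x\<close> is the mean of \<open>g (x + \<epsilon> z)\<close> under the density
  \<open>\<eta>\<close>. As the derivatives of \<open>\<eta>\<close> have mean zero, the Hessian at \<open>x\<close> is \<open>- 1 / \<epsilon>\<close> times the integral
  of the outer product of \<open>\<Delta>(z)\<close> and \<open>grad \<eta> z\<close> (\<open>hessian_mollify_eq_mean_hessian\<close>). As
  \<open>norm g = 1\<close>, the defect \<open>1 - (norm (grad \<psi>\<^sub>\<epsilon>))\<^sup>2\<close> is the variance of \<open>g (x + \<epsilon> z)\<close>, hence at most
  the mean of \<open>(norm (\<Delta>(z)))\<^sup>2\<close> (\<open>defect_bounds\<close>).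

  Hoelder's inequality, with the weight \<open>1 / norm z\<close> distributed between the two factors
  (\<open>weighted_hoelder_unit_ball\<close>), turns these two facts into \<open>hessian_bound\<close> and \<open>defect_bound\<close>: each
  integrand is at most its constant times the integral of \<open>(norm (\<Delta>(z))) powr r / (\<epsilon> * norm z)\<close> over
  the unit ball, with \<open>r\<close> equal to \<open>q\<close> and \<open>p\<close> respectively. Integrating in \<open>x\<close> and taking limits superior gives
  the first inequality. The cubic case adds Young's inequality for the product
  (\<open>product_bound\<close>), and Tonelli's theorem for the second form of the energy
  (\<open>energy_eq_shift\<close>).

  The weak gradient is only Lebesgue measurable and only of unit length almost everywhere. It is
  therefore replaced by a Borel representative of length exactly 1 on a compact
  neighbourhood of \<open>closure \<Omega>0\<close> inside \<open>\<Omega>\<close>; every functional involved is insensitive to this change.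
\<close>

section \<open>A weighted Hoelder inequality\<close>

text \<open>
  The factor containing \<open>w\<close> is an extended nonnegative integral, because in dimension one the
  difference quotients below may have infinite energy. If it is infinite, so is the right-hand side
  unless \<open>u\<close> vanishes almost everywhere, and then the left-hand side vanishes too. If both
  factors are positive and finite, they are normalised to mass one and Young's inequality is integrated.
\<close>

lemma hoelder_nn_integral:
  fixes u w :: "'a \<Rightarrow> real"
  assumes r: "1 < r"
    and [measurable]: "u \<in> borel_measurable M" "w \<in> borel_measurable M"
    and nonneg: "\<And>x. 0 \<le> u x" "\<And>x. 0 \<le> w x"
    and int_uw: "integrable M (\<lambda>x. u x * w x)"
    and int_u: "integrable M (\<lambda>x. u x powr (r / (r - 1)))"
  shows "ennreal ((LINT x|M. u x * w x) powr r)
    \<le> ennreal ((LINT x|M. u x powr (r / (r - 1))) powr (r - 1)) * (\<integral>\<^sup>+x. ennreal (w x powr r) \<partial>M)"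
proof -
  define s where "s = r / (r - 1)"
  define A where "A = (LINT x|M. u x powr s)"
  have s: "1 < s" "1 / s + 1 / r = 1" "0 < r" using r by (auto simp: s_def field_simps)
  have int_us: "integrable M (\<lambda>x. u x powr s)" using int_u by (simp add: s_def)
  have A0: "0 \<le> A" unfolding A_def by (rule integral_nonneg_AE) auto
  show ?thesis
  proof (cases "A = 0")
    case True
    then have "AE x in M. u x powr s = 0"
      using integral_nonneg_eq_0_iff_AE[OF int_us] by (simp add: A_def)
    then have "(LINT x|M. u x * w x) = (LINT x|M. 0)"
      by (intro integral_cong_AE) auto
    then show ?thesis using r by simp
  next
    case False
    with A0 have A: "0 < A" by simp
    show ?thesis
    proof (cases "(\<integral>\<^sup>+x. ennreal (w x powr r) \<partial>M) < \<infinity>")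
      case infin: False
      then have "(\<integral>\<^sup>+x. ennreal (w x powr r) \<partial>M) = top" by (metis infinity_ennreal_def top.not_eq_extremum)
      moreover have "ennreal (A powr (r - 1)) \<noteq> 0" using A by simp
      ultimately have "ennreal (A powr (r - 1)) * (\<integral>\<^sup>+x. ennreal (w x powr r) \<partial>M) = top"
        by (simp add: ennreal_mult_top)
      then show ?thesis by (simp add: A_def s_def)
    next
      case True
      then have int_w: "integrable M (\<lambda>x. w x powr r)"
        by (intro integrableI_bounded) auto
      define B where "B = (LINT x|M. w x powr r)"
      have B0: "0 \<le> B" unfolding B_def by (rule integral_nonneg_AE) auto
      have nnB: "(\<integral>\<^sup>+x. ennreal (w x powr r) \<partial>M) = ennreal B"
        unfolding B_def using int_w by (rule nn_integral_eq_integral) auto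
      have "(LINT x|M. u x * w x) powr r \<le> A powr (r - 1) * B"
      proof (cases "B = 0")
        case True
        then have "AE x in M. w x powr r = 0"
          using integral_nonneg_eq_0_iff_AE[OF int_w] by (simp add: B_def)
        then have "(LINT x|M. u x * w x) = (LINT x|M. 0)"
          by (intro integral_cong_AE) auto
        then show ?thesis using True by simp
      next
        case False
        with B0 have B: "0 < B" by simp
        define a b where "a = A powr (1 / s)" and "b = B powr (1 / r)"
        have ab: "0 < a" "0 < b" "a powr s = A" "b powr r = B"
          using A B s by (auto simp: a_def b_def powr_powr)
        have "u x * w x \<le> a * b * (u x powr s / (A * s) + w x powr r / (B * r))" for x
        proof -
          have "(u x / a) * (w x / b) \<le> (u x / a) powr s / s + (w x / b) powr r / r"
            using ab nonneg by (intro Youngs_inequality s r) auto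
          also have "\<dots> = u x powr s / (A * s) + w x powr r / (B * r)"
            using ab nonneg by (simp add: powr_divide)
          finally show ?thesis using ab by (simp add: field_simps)
        qed
        then have "(LINT x|M. u x * w x)
            \<le> (LINT x|M. a * b * (u x powr s / (A * s) + w x powr r / (B * r)))"
          using int_us int_w int_uw by (intro integral_mono) auto
        also have "\<dots> = a * b * (A / (A * s) + B / (B * r))"
          using int_us int_w by (simp add: A_def B_def)
        also have "\<dots> = a * b" using A B s by simp
        finally have "(LINT x|M. u x * w x) powr r \<le> (a * b) powr r"
          using s nonneg by (intro powr_mono2 integral_nonneg_AE) auto
        also have "\<dots> = A powr (r / s) * B"
          using ab by (simp add: powr_mult a_def powr_powr)
        also have "r / s = r - 1" using r by (simp add: s_def)
        finally show ?thesis .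
      qed
      then show ?thesis unfolding nnB using B0
        by (simp add: A_def s_def flip: ennreal_mult)
    qed
  qed
qed

text \<open>
  This is Hoelder's inequality for the splitting
  \<open>k * d = (k * norm z powr (1 / r)) * (d * norm z powr (- 1 / r))\<close>: it moves the singular
  weight \<open>1 / norm z\<close> onto the difference quotient and leaves a power of \<open>norm z\<close> with the
  kernel, which is how the weights in \<open>hessian_const\<close> and \<open>defect_const\<close> arise.
\<close>

lemma weighted_hoelder_unit_ball:
  fixes k d :: "'a::euclidean_space \<Rightarrow> real"
  assumes r: "1 < r"
    and [measurable]: "k \<in> borel_measurable borel" "d \<in> borel_measurable borel"
    and nonneg: "\<And>z. 0 \<le> k z" "\<And>z. 0 \<le> d z"
    and supp_k: "\<And>z. z \<notin> ball 0 1 \<Longrightarrow> k z = 0"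
    and int_kd: "integrable lborel (\<lambda>z. k z * d z)"
    and int_k: "integrable lborel (\<lambda>z. norm z powr (1 / (r - 1)) * k z powr (r / (r - 1)))"
  shows "ennreal ((LINT z|lborel. k z * d z) powr r)
    \<le> ennreal ((LINT z|lborel. norm z powr (1 / (r - 1)) * k z powr (r / (r - 1))) powr (r - 1))
      * (\<integral>\<^sup>+z\<in>ball 0 1. ennreal (d z powr r / norm z) \<partial>lborel)"
proof -
  define u where "u z = k z * norm z powr (1 / r)" for z
  define w where "w z = d z * norm z powr (- 1 / r) * indicator (ball 0 1) z" for z
  have [measurable]: "ball (0::'a) 1 \<in> sets borel" by simp
  have [measurable]: "u \<in> borel_measurable borel" "w \<in> borel_measurable borel"
    unfolding u_def[abs_def] w_def[abs_def] by measurable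
  have pos: "\<And>z. 0 \<le> u z" "\<And>z. 0 \<le> w z" using nonneg by (auto simp: u_def w_def)
  have ae0: "AE z in lborel. z \<noteq> (0::'a)" by (rule AE_lborel_singleton)
  have uw: "AE z in lborel. k z * d z = u z * w z"
    using ae0
  proof eventually_elim
    case (elim z)
    have "norm z powr (1 / r) * norm z powr (- 1 / r) = 1"
      using elim by (simp flip: powr_add)
    then show ?case using supp_k[of z]
      by (auto simp: u_def w_def indicator_def algebra_simps)
  qed
  have us: "u z powr (r / (r - 1)) = norm z powr (1 / (r - 1)) * k z powr (r / (r - 1))" for z
    using r nonneg by (simp add: u_def powr_mult powr_powr mult.commute)
  have ws: "AE z in lborel. ennreal (w z powr r) = ennreal (d z powr r / norm z) * indicator (ball 0 1) z"
    using ae0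
  proof eventually_elim
    case (elim z)
    have "(norm z powr (- 1 / r)) powr r = 1 / norm z"
      using elim r by (simp add: powr_powr powr_minus_divide powr_divide)
    then show ?case using r nonneg
      by (auto simp: w_def powr_mult indicator_def)
  qed
  have "ennreal ((LINT z|lborel. u z * w z) powr r)
    \<le> ennreal ((LINT z|lborel. u z powr (r / (r - 1))) powr (r - 1)) * (\<integral>\<^sup>+z. ennreal (w z powr r) \<partial>lborel)"
  proof (intro hoelder_nn_integral r pos)
    show "integrable lborel (\<lambda>z. u z * w z)"
      by (rule integrable_cong_AE_imp[OF int_kd]) (use uw in auto)
    show "integrable lborel (\<lambda>z. u z powr (r / (r - 1)))"
      using int_k by (simp only: us)
  qed auto
  also have "(LINT z|lborel. u z * w z) = (LINT z|lborel. k z * d z)"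
    using uw by (intro integral_cong_AE) auto
  also have "(\<integral>\<^sup>+z. ennreal (w z powr r) \<partial>lborel) = (\<integral>\<^sup>+z\<in>ball 0 1. ennreal (d z powr r / norm z) \<partial>lborel)"
    using ws by (rule nn_integral_cong_AE)
  finally show ?thesis by (simp only: us)
qed

section \<open>Limits superior of extended nonnegative functions\<close>

lemma Limsup_add_le_ennreal:
  fixes f g :: "'a \<Rightarrow> ennreal"
  shows "Limsup F (\<lambda>x. f x + g x) \<le> Limsup F f + Limsup F g"
proof (cases "Limsup F f = top \<or> Limsup F g = top")
  case False
  show ?thesis
  proof (rule ennreal_le_epsilon)
    fix e :: real assume "0 < e" "Limsup F f + Limsup F g < top"
    have less: "a < a + ennreal (e / 2)" if "a \<noteq> top" for a :: ennreal
      using that \<open>0 < e\<close> ennreal_add_left_cancel_less[of a 0 "ennreal (e / 2)"] by simp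
    have "eventually (\<lambda>x. f x < Limsup F f + ennreal (e / 2)) F"
      "eventually (\<lambda>x. g x < Limsup F g + ennreal (e / 2)) F"
      using False by (auto intro!: Limsup_lessD less)
    then have "eventually (\<lambda>x. f x + g x \<le> Limsup F f + Limsup F g + ennreal e) F"
    proof eventually_elim
      case (elim x)
      then have "f x + g x \<le> (Limsup F f + ennreal (e / 2)) + (Limsup F g + ennreal (e / 2))"
        by (intro add_mono) auto
      also have "\<dots> = Limsup F f + Limsup F g + (ennreal (e / 2) + ennreal (e / 2))"
        by (simp add: algebra_simps)
      also have "ennreal (e / 2) + ennreal (e / 2) = ennreal e"
        using \<open>0 < e\<close> by (simp flip: ennreal_plus)
      finally show ?case .
    qed
    then show "Limsup F (\<lambda>x. f x + g x) \<le> Limsup F f + Limsup F g + ennreal e"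
      by (rule Limsup_bounded)
  qed
qed auto

lemma Limsup_cmult_ennreal:
  fixes f :: "'a \<Rightarrow> ennreal"
  assumes "F \<noteq> bot"
  shows "Limsup F (\<lambda>x. ennreal c * f x) = ennreal c * Limsup F f"
  by (rule Limsup_compose_continuous_mono[OF _ _ assms, where f = "\<lambda>x. ennreal c * x"])
     (auto simp: continuous_on_def intro!: ennreal_tendsto_cmult tendsto_ident_at monoI mult_left_mono)

section \<open>Calculus of smooth, compactly supported kernels\<close>

lemma grad_inner_eq_frechet:
  fixes f :: "real^'n \<Rightarrow> real"
  assumes "f differentiable (at x)"
  shows "frechet_derivative f (at x) v = grad f x \<bullet> v"
proof -
  have lin: "linear (frechet_derivative f (at x))"
    using assms by (rule linear_frechet_derivative)
  have "frechet_derivative f (at x) v = frechet_derivative f (at x) (\<Sum>i\<in>UNIV. v $ i *\<^sub>R axis i 1)"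
    using basis_expansion[of v] by (simp add: scalar_mult_eq_scaleR)
  also have "\<dots> = grad f x \<bullet> v"
    using lin by (simp add: linear_sum linear_scale grad_def partial_def inner_vec_def mult.commute)
  finally show ?thesis .
qed

lemma grad_eqI:
  fixes f :: "real^'n \<Rightarrow> real"
  assumes "(f has_derivative (\<lambda>v. w \<bullet> v)) (at x)"
  shows "grad f x = w"
  unfolding grad_def partial_def frechet_derivative_at[OF assms, symmetric]
  by (simp add: vec_eq_iff inner_axis)

lemma smooth_partial: "smooth f \<Longrightarrow> smooth (partial i f)"
  unfolding smooth_def by (metis C_k.simps(2))

lemma smooth_differentiable: "smooth f \<Longrightarrow> f differentiable (at x)"
  unfolding smooth_def by (metis C_k.simps(2))

lemma smooth_continuous: "smooth f \<Longrightarrow> continuous_on UNIV f"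
  unfolding smooth_def by (metis C_k.simps(1))

lemma smooth_has_derivative:
  assumes "smooth f"
  shows "(f has_derivative (\<lambda>v. grad f x \<bullet> v)) (at x)"
proof -
  have diff: "f differentiable (at x)" using assms by (rule smooth_differentiable)
  then have "frechet_derivative f (at x) = (\<lambda>v. grad f x \<bullet> v)"
    by (intro ext grad_inner_eq_frechet)
  with diff show ?thesis by (simp add: frechet_derivative_works)
qed

lemma smooth_continuous_grad: "smooth f \<Longrightarrow> continuous_on UNIV (grad f)"
  unfolding grad_def[abs_def]
  by (intro continuous_on_vec_lambda smooth_continuous smooth_partial)

lemma partial_affine:
  fixes f :: "real^'n \<Rightarrow> real"
  assumes "\<And>y. f differentiable (at y)"
  shows "partial i (\<lambda>y. c * f (a *\<^sub>R (y - x))) = (\<lambda>y. (c * a) * partial i f (a *\<^sub>R (y - x)))"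
    and "(\<lambda>y. c * f (a *\<^sub>R (y - x))) differentiable (at y)"
proof -
  have D: "((\<lambda>y. c * f (a *\<^sub>R (y - x))) has_derivative
      (\<lambda>v. c * frechet_derivative f (at (a *\<^sub>R (y - x))) (a *\<^sub>R v))) (at y)" for y
  proof -
    have "((\<lambda>y. f (a *\<^sub>R (y - x))) has_derivative
      (\<lambda>v. frechet_derivative f (at (a *\<^sub>R (y - x))) (a *\<^sub>R v))) (at y)"
      by (rule has_derivative_compose[of "\<lambda>y. a *\<^sub>R (y - x)" _ y UNIV f])
         (use assms in \<open>auto intro!: derivative_eq_intros simp flip: frechet_derivative_works\<close>)
    then show ?thesis by (rule has_derivative_mult_right)
  qed
  show "(\<lambda>y. c * f (a *\<^sub>R (y - x))) differentiable (at y)"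
    using D[of y] by (rule differentiableI)
  show "partial i (\<lambda>y. c * f (a *\<^sub>R (y - x))) = (\<lambda>y. (c * a) * partial i f (a *\<^sub>R (y - x)))"
  proof
    fix y
    have "linear (frechet_derivative f (at (a *\<^sub>R (y - x))))"
      using assms by (rule linear_frechet_derivative)
    then show "partial i (\<lambda>y. c * f (a *\<^sub>R (y - x))) y = (c * a) * partial i f (a *\<^sub>R (y - x))"
      using frechet_derivative_at[OF D[of y]] 
      by (simp add: partial_def fun_eq_iff linear_scale flip: mult.assoc)
  qed
qed

lemma C_k_affine: "C_k k f \<Longrightarrow> C_k k (\<lambda>y. c * f (a *\<^sub>R (y - x)))"
proof (induction k arbitrary: f c)
  case 0
  then have "continuous_on UNIV f" by simp
  then show ?case 
    by (auto intro!: continuous_intros continuous_on_compose2[of UNIV f])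
next
  case (Suc k)
  show ?case
    unfolding C_k.simps
  proof (intro conjI allI)
    show "(\<lambda>y. c * f (a *\<^sub>R (y - x))) differentiable (at y)" for y
      using Suc.prems by (intro partial_affine(2)) auto
    show "C_k k (partial i (\<lambda>y. c * f (a *\<^sub>R (y - x))))" for i
      using Suc by (subst partial_affine(1)) auto
  qed
qed

lemma smooth_affine: "smooth f \<Longrightarrow> smooth (\<lambda>y. f (a *\<^sub>R (y - x)))"
  using C_k_affine[of _ f 1 a x] by (simp add: smooth_def)

lemma grad_eq_0_off_supp:
  assumes "z \<notin> supp f"
  shows "f z = 0" "grad f z = 0"
proof -
  have off: "f y = 0" if "y \<notin> supp f" for y
    using that subsetD[OF closure_subset, of y "{x. f x \<noteq> 0}"] by (auto simp: supp_def)
  show "f z = 0" using assms by (rule off)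
  have "open (- supp f)" by (simp add: supp_def open_Compl)
  have "((\<lambda>_. 0) has_derivative (\<lambda>v. 0 \<bullet> v)) (at z)" by simp
  then have "(f has_derivative (\<lambda>v. 0 \<bullet> v)) (at z)"
    by (rule has_derivative_transform_within_open[OF _ \<open>open (- supp f)\<close>]) (use assms off in auto)
  then show "grad f z = 0" by (rule grad_eqI)
qed

text \<open>
  Uniform continuity on the compact ball of radius 3 is enough: of two points at distance
  less than 1, either both lie in that ball or both lie outside the support.
\<close>

lemma uniformly_continuous_compact_support:
  fixes f :: "'a::euclidean_space \<Rightarrow> 'b::real_normed_vector"
  assumes cont: "continuous_on UNIV f" and zero: "\<And>z. z \<notin> cball 0 1 \<Longrightarrow> f z = 0"
  shows "uniformly_continuous_on UNIV f"
proof -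
  have uc: "uniformly_continuous_on (cball 0 3) f"
    using cont by (intro compact_uniformly_continuous) (auto intro: continuous_on_subset)
  show ?thesis
    unfolding uniformly_continuous_on_def
  proof (intro allI impI)
    fix e :: real assume "0 < e"
    then obtain d where d: "0 < d"
      "\<And>x y. x \<in> cball 0 3 \<Longrightarrow> y \<in> cball 0 3 \<Longrightarrow> dist y x < d \<Longrightarrow> dist (f y) (f x) < e"
      using uc[unfolded uniformly_continuous_on_def, rule_format, OF \<open>0 < e\<close>] by metis
    have "dist (f y) (f x) < e" if xy: "dist y x < min d 1" for x y
    proof (cases "x \<in> cball 0 2")
      case True
      then have "x \<in> cball 0 3" "y \<in> cball 0 3"
        using xy norm_triangle_sub[of y x] by (simp_all add: dist_norm)
      then show ?thesis using d xy by auto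
    next
      case False
      then have "x \<notin> cball 0 1" "y \<notin> cball 0 1"
        using xy norm_triangle_sub[of x y] by (simp_all add: dist_norm norm_minus_commute)
      then show ?thesis using zero \<open>0 < e\<close> by simp
    qed
    then show "\<exists>d>0. \<forall>x\<in>UNIV. \<forall>x'\<in>UNIV. dist x' x < d \<longrightarrow> dist (f x') (f x) < e"
      using \<open>0 < d\<close> by (intro exI[of _ "min d 1"] conjI ballI impI) simp_all
  qed
qed

text \<open>
  The first-order Taylor error is \<open>o(norm u)\<close> uniformly in the base point. This uniformity is
  what allows a convolution with a merely integrable function to be differentiated under the
  integral sign without a dominated convergence argument.
\<close>

lemma smooth_uniform_linearization:
  fixes k :: "real^'n \<Rightarrow> real"
  assumes k: "smooth k" "supp k \<subseteq> cball 0 1" and "0 < e"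
  obtains d where "0 < d"
    "\<And>w u. norm u < d \<Longrightarrow> \<bar>k (w + u) - k w - grad k w \<bullet> u\<bar> \<le> e * norm u"
proof -
  have uc: "uniformly_continuous_on UNIV (grad k)"
    using k subsetD[OF k(2)]
    by (intro uniformly_continuous_compact_support smooth_continuous_grad grad_eq_0_off_supp(2)) auto
  then obtain d where d: "0 < d" "\<And>x y. dist y x < d \<Longrightarrow> dist (grad k y) (grad k x) < e"
    using uc[unfolded uniformly_continuous_on_def, rule_format, OF \<open>0 < e\<close>] by (metis UNIV_I)
  have "\<bar>k (w + u) - k w - grad k w \<bullet> u\<bar> \<le> e * norm u" if "norm u < d" for w u
  proof -
    have "norm (k (w + u) - k w - grad k w \<bullet> (w + u - w)) \<le> norm (w + u - w) * e"
    proof (rule differentiable_bound_linearization[where S = "ball w d" and f' = "\<lambda>x v. grad k x \<bullet> v"])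
      fix t :: real assume "t \<in> {0..1}"
      then have "\<bar>t\<bar> * norm u \<le> norm u" by (intro mult_left_le_one_le) auto
      then show "w + t *\<^sub>R (w + u - w) \<in> ball w d" using that by (simp add: dist_norm)
    next
      fix x assume "x \<in> ball w d"
      then have "norm (grad k x - grad k w) \<le> e"
        using d(2)[of x w] by (simp add: dist_norm norm_minus_commute)
      moreover have "onorm (\<lambda>v. (grad k x - grad k w) \<bullet> v) \<le> norm (grad k x - grad k w)"
        by (intro onorm_bound) (auto intro: Cauchy_Schwarz_ineq2)
      ultimately show "onorm ((\<lambda>v. grad k x \<bullet> v) - (\<lambda>v. grad k w \<bullet> v)) \<le> e"
        by (simp add: fun_diff_def inner_diff_left)
    qed (use k d in \<open>auto intro: has_derivative_at_withinI smooth_has_derivative\<close>)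
    then show ?thesis by (simp add: mult.commute)
  qed
  with d(1) that show ?thesis by blast
qed

lemma continuous_compact_support_bounded:
  fixes f :: "'a::euclidean_space \<Rightarrow> 'b::real_normed_vector"
  assumes cont: "continuous_on UNIV f" and zero: "\<And>z. z \<notin> cball 0 1 \<Longrightarrow> f z = 0"
  obtains B where "0 < B" "\<And>z. norm (f z) \<le> B"
proof -
  have "bounded (f ` cball 0 1)"
    using cont by (intro compact_imp_bounded compact_continuous_image) (auto intro: continuous_on_subset)
  then obtain B where B: "0 < B" "\<And>z. z \<in> cball 0 1 \<Longrightarrow> norm (f z) \<le> B"
    unfolding bounded_pos by blast
  then have "norm (f z) \<le> B" for z
    using zero[of z] by (cases "z \<in> cball 0 1") auto
  with B(1) that show ?thesis by blast
qed

lemma integrable_kernel_mult: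
  fixes k :: "'a::euclidean_space \<Rightarrow> real" and h :: "'a \<Rightarrow> 'b::euclidean_space"
  assumes k: "continuous_on UNIV k" "\<And>z. z \<notin> cball 0 1 \<Longrightarrow> k z = 0" and h: "integrable lebesgue h"
  shows "integrable lebesgue (\<lambda>y. k (a *\<^sub>R (y - x)) *\<^sub>R h y)"
proof -
  obtain B where B: "0 < B" "\<And>z. norm (k z) \<le> B"
    using continuous_compact_support_bounded[OF k] by blast
  have "(\<lambda>y. k (a *\<^sub>R (y - x))) \<in> borel_measurable borel"
    by (intro borel_measurable_continuous_onI)
       (auto intro!: continuous_on_compose2[OF k(1)] continuous_intros)
  then have [measurable]: "(\<lambda>y. k (a *\<^sub>R (y - x))) \<in> borel_measurable lebesgue"
    by (intro measurable_completion) simp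
  have [measurable]: "h \<in> borel_measurable lebesgue" using h by auto
  show ?thesis
    by (rule Bochner_Integration.integrable_bound[OF integrable_scaleR_right[OF h, of B]])
       (use B in \<open>auto intro!: mult_right_mono\<close>)
qed

text \<open>
  Moving \<open>x\<close> shifts the argument of the kernel by the same vector \<open>u = - a *\<^sub>R (y - x)\<close> for all
  integration points. By the uniform linearization the error of the candidate derivative is
  at most \<open>e' * norm u\<close> times the \<open>L\<^sup>1\<close> norm of \<open>h\<close>.
\<close>

lemma kernel_convolution_has_derivative:
  fixes k h :: "real^'n \<Rightarrow> real"
  assumes k: "smooth k" "supp k \<subseteq> cball 0 1" and h: "integrable lebesgue h"
  shows "((\<lambda>x. LINT y|lebesgue. k (a *\<^sub>R (y - x)) * h y) has_derivative
    (\<lambda>v. (\<chi> i. - a * (LINT y|lebesgue. partial i k (a *\<^sub>R (y - x)) * h y)) \<bullet> v)) (at x)"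
proof -
  have supp0: "k z = 0" "partial i k z = 0" if "z \<notin> cball 0 1" for z i
    using grad_eq_0_off_supp[of z k] subsetD[OF k(2), of z] that by (auto simp: grad_def vec_eq_iff)
  have int: "integrable lebesgue (\<lambda>y. k (a *\<^sub>R (y - x)) * h y)" for x
    using integrable_kernel_mult[OF smooth_continuous[OF k(1)] supp0(1) h] by simp
  have int': "integrable lebesgue (\<lambda>y. partial i k (a *\<^sub>R (y - x)) * h y)" for i x
    using integrable_kernel_mult[OF smooth_continuous[OF smooth_partial[OF k(1)]] supp0(2) h] by simp
  define W where "W = (\<chi> i. - a * (LINT y|lebesgue. partial i k (a *\<^sub>R (y - x)) * h y))"
  have expand: "(grad k (a *\<^sub>R (y - x)) \<bullet> v) * h y
      = (\<Sum>i\<in>UNIV. v $ i * (partial i k (a *\<^sub>R (y - x)) * h y))" for v y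
    by (simp add: inner_vec_def grad_def sum_distrib_right sum_distrib_left mult_ac)
  have intg: "integrable lebesgue (\<lambda>y. (grad k (a *\<^sub>R (y - x)) \<bullet> v) * h y)" for v
    unfolding expand using int' by (intro Bochner_Integration.integrable_sum integrable_mult_right)
  have W: "W \<bullet> v = - a * (LINT y|lebesgue. (grad k (a *\<^sub>R (y - x)) \<bullet> v) * h y)" for v
  proof -
    have "(LINT y|lebesgue. (grad k (a *\<^sub>R (y - x)) \<bullet> v) * h y)
        = (LINT y|lebesgue. (\<Sum>i\<in>UNIV. v $ i * (partial i k (a *\<^sub>R (y - x)) * h y)))"
      by (simp only: expand)
    also have "\<dots> = (\<Sum>i\<in>UNIV. v $ i * (LINT y|lebesgue. (partial i k (a *\<^sub>R (y - x)) * h y)))"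
      using int' by (subst Bochner_Integration.integral_sum) auto
    finally show ?thesis by (simp add: W_def inner_vec_def sum_distrib_left mult_ac)
  qed
  have "((\<lambda>x. LINT y|lebesgue. k (a *\<^sub>R (y - x)) * h y) has_derivative (\<lambda>v. W \<bullet> v)) (at x)"
    unfolding has_derivative_at_alt
  proof (intro conjI allI impI)
    show "bounded_linear ((\<bullet>) W)" by (rule bounded_linear_inner_right)
    fix e :: real assume "0 < e"
    define I where "I = (LINT y|lebesgue. \<bar>h y\<bar>)"
    have I: "0 \<le> I" unfolding I_def by (rule integral_nonneg_AE) auto
    \<comment> \<open>chosen to absorb the dilation factor and the mass of \<open>h\<close>; the summands 1 avoid division by 0\<close>
    define e' where "e' = e / ((\<bar>a\<bar> + 1) * (I + 1))"
    have e': "0 < e'" using \<open>0 < e\<close> I by (simp add: e'_def)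
    obtain d where d: "0 < d"
      "\<And>w u. norm u < d \<Longrightarrow> \<bar>k (w + u) - k w - grad k w \<bullet> u\<bar> \<le> e' * norm u"
      using smooth_uniform_linearization[OF k e'] by blast
    show "\<exists>d>0. \<forall>y. norm (y - x) < d \<longrightarrow>
           norm ((LINT z|lebesgue. k (a *\<^sub>R (z - y)) * h z) -
             (LINT y|lebesgue. k (a *\<^sub>R (y - x)) * h y) - W \<bullet> (y - x)) \<le> e * norm (y - x)"
    proof (intro exI[of _ "d / (\<bar>a\<bar> + 1)"] conjI allI impI)
      show "0 < d / (\<bar>a\<bar> + 1)" using d by simp
      fix y assume y: "norm (y - x) < d / (\<bar>a\<bar> + 1)"
      define u where "u = - a *\<^sub>R (y - x)"
      have "norm u \<le> (\<bar>a\<bar> + 1) * norm (y - x)" by (simp add: u_def mult_right_mono)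
      also have "\<dots> < d" using y by (simp add: field_simps)
      finally have u: "norm u < d" .
      have shift: "a *\<^sub>R (z - y) = a *\<^sub>R (z - x) + u" for z
        by (simp add: u_def algebra_simps)
      have Wu: "W \<bullet> (y - x) = (LINT z|lebesgue. (grad k (a *\<^sub>R (z - x)) \<bullet> u) * h z)"
        by (simp add: W u_def mult.assoc)
      have "(LINT z|lebesgue. k (a *\<^sub>R (z - y)) * h z) -
             (LINT z|lebesgue. k (a *\<^sub>R (z - x)) * h z) - W \<bullet> (y - x)
          = (LINT z|lebesgue. k (a *\<^sub>R (z - y)) * h z - k (a *\<^sub>R (z - x)) * h z - (grad k (a *\<^sub>R (z - x)) \<bullet> u) * h z)"
        using int int[of y] intg unfolding Wu by simp
      also have "norm \<dots> \<le> (LINT z|lebesgue. (e' * norm u) * \<bar>h z\<bar>)"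
      proof (rule Bochner_Integration.integral_norm_bound_integral)
        show "integrable lebesgue (\<lambda>z. k (a *\<^sub>R (z - y)) * h z - k (a *\<^sub>R (z - x)) * h z - (grad k (a *\<^sub>R (z - x)) \<bullet> u) * h z)"
          using int int[of y] intg by auto
        show "integrable lebesgue (\<lambda>z. (e' * norm u) * \<bar>h z\<bar>)" using h by auto
        fix z
        have "\<bar>k (a *\<^sub>R (z - y)) - k (a *\<^sub>R (z - x)) - grad k (a *\<^sub>R (z - x)) \<bullet> u\<bar> * \<bar>h z\<bar> \<le> (e' * norm u) * \<bar>h z\<bar>"
          using d(2)[OF u] by (intro mult_right_mono) (auto simp: shift)
        then show "norm (k (a *\<^sub>R (z - y)) * h z - k (a *\<^sub>R (z - x)) * h z - (grad k (a *\<^sub>R (z - x)) \<bullet> u) * h z) \<le> (e' * norm u) * \<bar>h z\<bar>"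
          by (simp add: left_diff_distrib flip: abs_mult)
      qed
      also have "\<dots> = e' * norm u * I" using h by (simp add: I_def)
      also have "\<dots> \<le> e' * ((\<bar>a\<bar> + 1) * norm (y - x)) * (I + 1)"
        using e' I \<open>norm u \<le> (\<bar>a\<bar> + 1) * norm (y - x)\<close> by (intro mult_mono) auto
      also have "\<dots> = e' * ((\<bar>a\<bar> + 1) * (I + 1)) * norm (y - x)" by (simp only: mult_ac)
      also have "\<dots> = e * norm (y - x)"
      proof -
        have "\<bar>a\<bar> + 1 \<noteq> 0" "I + 1 \<noteq> 0" using I by linarith+
        then show ?thesis unfolding e'_def by simp
      qed
      finally show "norm ((LINT z|lebesgue. k (a *\<^sub>R (z - y)) * h z) -
             (LINT y|lebesgue. k (a *\<^sub>R (y - x)) * h y) - W \<bullet> (y - x)) \<le> e * norm (y - x)" .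
    qed
  qed
  then show ?thesis by (simp only: W_def)
qed

section \<open>Affine changes of variables and bounded integrands\<close>

lemma nn_integral_affine_lborel:
  fixes t :: "'a::euclidean_space" and f :: "'a \<Rightarrow> ennreal"
  assumes "c \<noteq> 0" and [measurable]: "f \<in> borel_measurable borel"
  shows "(\<integral>\<^sup>+y. f y \<partial>lborel) = ennreal (\<bar>c\<bar> ^ DIM('a)) * (\<integral>\<^sup>+z. f (t + c *\<^sub>R z) \<partial>lborel)"
  by (subst lborel_affine[OF assms(1), of t])
     (simp add: nn_integral_density nn_integral_distr nn_integral_cmult)

lemma integral_affine_lborel:
  fixes t :: "'a::euclidean_space" and f :: "'a \<Rightarrow> 'b::{banach, second_countable_topology}"
  assumes "c \<noteq> 0" and [measurable]: "f \<in> borel_measurable borel"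
  shows "(LINT y|lborel. f y) = (\<bar>c\<bar> ^ DIM('a)) *\<^sub>R (LINT z|lborel. f (t + c *\<^sub>R z))"
  by (subst lborel_affine[OF assms(1), of t])
     (simp add: integral_density integral_distr)

lemma AE_affine_lborel:
  fixes t :: "'a::euclidean_space"
  assumes "c \<noteq> 0" and P: "AE y in lborel. P y"
  shows "AE z in lborel. P (t + c *\<^sub>R z)"
proof -
  obtain N where N: "{y. \<not> P y} \<subseteq> N" "N \<in> null_sets lborel"
    using P by (auto elim!: AE_E simp: null_sets_def)
  then have [measurable]: "N \<in> sets borel" by auto
  have "(\<integral>\<^sup>+y. indicator N y \<partial>lborel) = 0" using N by (simp add: null_sets_def)
  then have "ennreal (\<bar>c\<bar> ^ DIM('a)) * (\<integral>\<^sup>+z. indicator N (t + c *\<^sub>R z) \<partial>lborel) = 0"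
    using nn_integral_affine_lborel[OF assms(1), of "indicator N" t] by simp
  then have "(\<integral>\<^sup>+z. indicator N (t + c *\<^sub>R z) \<partial>lborel) = 0"
    using assms(1) by simp
  then have "AE z in lborel. indicator N (t + c *\<^sub>R z) = (0::ennreal)"
    by (subst (asm) nn_integral_0_iff_AE) auto
  then show ?thesis
    by eventually_elim (use N in \<open>auto simp: indicator_def split: if_splits\<close>)
qed

lemma integrable_bounded_in_unit_ball:
  fixes f :: "'a::euclidean_space \<Rightarrow> 'b::{banach, second_countable_topology}"
  assumes "f \<in> borel_measurable borel" and "\<And>z. norm (f z) \<le> B" and "\<And>z. z \<notin> cball 0 1 \<Longrightarrow> f z = 0"
  shows "integrable lborel f"
proof (rule Bochner_Integration.integrable_bound)
  show "integrable lborel (\<lambda>z::'a. B * indicator (cball 0 1) z)"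
    by (intro integrable_mult_right integrable_real_indicator) (auto intro!: emeasure_bounded_finite[simplified])
  show "AE z in lborel. norm (f z) \<le> norm (B * indicator (cball 0 1) z)"
    using assms(2,3) by (auto simp: indicator_def intro: order_trans[OF _ abs_ge_self])
qed (use assms in auto)

lemma rescaled_in_unit_cball_iff:
  fixes x y :: "'a::real_normed_vector"
  assumes "0 < \<epsilon>"
  shows "(1 / \<epsilon>) *\<^sub>R (y - x) \<in> cball 0 1 \<longleftrightarrow> y \<in> cball x \<epsilon>"
proof -
  have nrm: "norm ((1 / \<epsilon>) *\<^sub>R (y - x)) = dist x y / \<epsilon>"
    using assms by (simp only: norm_scaleR dist_norm norm_minus_commute) simp
  show ?thesis unfolding mem_cball_0 nrm using assms by (simp add: field_simps)
qed

section \<open>Matrix-valued integrals\<close>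

definition outer :: "real^'n \<Rightarrow> real^'m \<Rightarrow> real^'m^'n" where
  "outer a b = (\<chi> i j. a $ i * b $ j)"

lemma norm_outer: "norm (outer a b) = norm a * norm b"
proof -
  have "outer a b $ i = a $ i *\<^sub>R b" for i by (simp add: outer_def vec_eq_iff)
  then have "norm (outer a b) = L2_set (\<lambda>i. norm (a $ i) * norm b) UNIV"
    by (simp only: norm_vec_def[of "outer a b"] norm_scaleR real_norm_def)
  also have "\<dots> = norm a * norm b" by (simp add: L2_set_left_distrib norm_vec_def)
  finally show ?thesis .
qed

lemma borel_measurable_vec_lambda:
  fixes f :: "'a \<Rightarrow> 'n::finite \<Rightarrow> 'b::euclidean_space"
  assumes "\<And>i. (\<lambda>x. f x i) \<in> borel_measurable M"
  shows "(\<lambda>x. \<chi> i. f x i) \<in> borel_measurable M"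
  by (subst borel_measurable_euclidean_space)
     (use assms in \<open>auto simp: Basis_vec_def inner_axis intro!: borel_measurable_inner\<close>)

lemma borel_measurable_vec_nth [measurable (raw)]:
  fixes f :: "'a \<Rightarrow> 'b::euclidean_space ^ 'n"
  assumes "f \<in> borel_measurable M"
  shows "(\<lambda>x. f x $ i) \<in> borel_measurable M"
  by (rule borel_measurable_continuous_on[OF _ assms]) (auto intro: continuous_intros)

lemma borel_measurable_outer [measurable (raw)]:
  assumes [measurable]: "f \<in> borel_measurable M" "h \<in> borel_measurable M"
  shows "(\<lambda>x. outer (f x) (h x)) \<in> borel_measurable M"
  unfolding outer_def by (intro borel_measurable_vec_lambda) measurable

lemma integral_vec_nth:
  fixes f :: "'a \<Rightarrow> 'b::euclidean_space ^ 'n"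
  assumes "integrable M f"
  shows "(LINT x|M. f x) $ i = (LINT x|M. f x $ i)"
  using integral_bounded_linear[OF bounded_linear_vec_nth assms] by simp

section \<open>The mollifying kernel\<close>

locale kernel =
  fixes \<eta> :: "real^'n \<Rightarrow> real"
  assumes smooth_eta: "smooth \<eta>" and supp_eta: "supp \<eta> \<subseteq> cball 0 1"
    and eta_nonneg: "\<And>z. 0 \<le> \<eta> z" and integral_eta: "(LINT z|lborel. \<eta> z) = 1"
begin

lemma measurable_eta [measurable]: "\<eta> \<in> borel_measurable borel"
  "partial i \<eta> \<in> borel_measurable borel" "grad \<eta> \<in> borel_measurable borel"
  using smooth_eta by (auto intro!: borel_measurable_continuous_onI smooth_continuous smooth_partial smooth_continuous_grad)

text \<open>
  A continuous function vanishing off the closed ball also vanishes on the sphere, because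
  its nonvanishing set is open and hence lies in the interior of the closed ball. The open ball
  is needed here since the difference quotients are integrated over open balls.
\<close>

lemma vanishes_off_unit_ball:
  assumes "z \<notin> ball 0 1"
  shows "\<eta> z = 0" "grad \<eta> z = 0"
proof -
  have *: "f z = 0" if cont: "continuous_on UNIV f" and off: "\<And>z. z \<notin> cball 0 1 \<Longrightarrow> f z = 0"
    for f :: "real^'n \<Rightarrow> 'c::real_normed_vector"
  proof -
    have "open (f -` (- {0}))"
      using cont by (intro open_vimage) auto
    then have "open {z. f z \<noteq> 0}" by (simp add: vimage_def)
    moreover have "{z. f z \<noteq> 0} \<subseteq> cball 0 1" using off by blast
    ultimately have "{z. f z \<noteq> 0} \<subseteq> interior (cball 0 1)" by (rule interior_maximal[rotated])
    then show ?thesis using assms by (auto simp: interior_cball)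
  qed
  show "\<eta> z = 0" using supp_eta
    by (intro *[OF smooth_continuous[OF smooth_eta]] grad_eq_0_off_supp) blast
  show "grad \<eta> z = 0" using supp_eta
    by (intro *[OF smooth_continuous_grad[OF smooth_eta]] grad_eq_0_off_supp) blast
qed

lemma vanishes_off_cball:
  assumes "z \<notin> cball 0 1"
  shows "\<eta> z = 0" "grad \<eta> z = 0" "partial i \<eta> z = 0"
proof -
  show "\<eta> z = 0" and *: "grad \<eta> z = 0" using vanishes_off_unit_ball[of z] assms by auto
  show "partial i \<eta> z = 0" using * by (simp add: grad_def vec_eq_iff)
qed

lemma kernel_bound:
  obtains B where "0 < B" "\<And>z. \<eta> z \<le> B" "\<And>z. norm (grad \<eta> z) \<le> B"
proof -
  obtain B1 where B1: "0 < B1" "\<And>z. norm (\<eta> z) \<le> B1"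
    using continuous_compact_support_bounded[OF smooth_continuous[OF smooth_eta] vanishes_off_cball(1)] by metis
  obtain B2 where B2: "0 < B2" "\<And>z. norm (grad \<eta> z) \<le> B2"
    using continuous_compact_support_bounded[OF smooth_continuous_grad[OF smooth_eta] vanishes_off_cball(2)] by metis
  have "\<eta> z \<le> max B1 B2" "norm (grad \<eta> z) \<le> max B1 B2" for z
    using B1(2)[of z] B2(2)[of z] by auto
  then show ?thesis using B1(1) by (intro that[of "max B1 B2"]) auto
qed

lemma integrable_eta_mult:
  fixes f :: "real^'n \<Rightarrow> 'b::euclidean_space"
  assumes [measurable]: "f \<in> borel_measurable borel" and "\<And>z. norm (f z) \<le> C"
  shows "integrable lborel (\<lambda>z. \<eta> z *\<^sub>R f z)"
    and "integrable lborel (\<lambda>z. partial i \<eta> z *\<^sub>R f z)"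
    and "integrable lborel (\<lambda>z. norm (grad \<eta> z) *\<^sub>R f z)"
proof -
  obtain B where B: "0 < B" "\<And>z. \<eta> z \<le> B" "\<And>z. norm (grad \<eta> z) \<le> B"
    using kernel_bound by metis
  have B': "\<bar>partial i \<eta> z\<bar> \<le> B" for z
    using B(3)[of z] component_le_norm_cart[of "grad \<eta> z" i] by (simp add: grad_def)
  have C: "0 \<le> C" using assms(2) norm_ge_zero order_trans by blast
  show "integrable lborel (\<lambda>z. \<eta> z *\<^sub>R f z)"
    using assms(2) B C eta_nonneg vanishes_off_cball(1)
    by (intro integrable_bounded_in_unit_ball[where B = "B * C"]) (auto intro!: mult_mono)
  show "integrable lborel (\<lambda>z. partial i \<eta> z *\<^sub>R f z)"
    using assms(2) B B' C vanishes_off_cball(3)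
    by (intro integrable_bounded_in_unit_ball[where B = "B * C"]) (auto intro!: mult_mono)
  show "integrable lborel (\<lambda>z. norm (grad \<eta> z) *\<^sub>R f z)"
    using assms(2) B C vanishes_off_cball(2)
    by (intro integrable_bounded_in_unit_ball[where B = "B * C"]) (auto intro!: mult_mono)
qed

text \<open>
  Convolving \<open>\<eta>\<close> with the indicator of a ball of radius 2 gives a function that is constant near
  the origin, and its derivative there is the integral in question up to the sign.
\<close>

lemma integral_partial_eta: "(LINT z|lborel. partial j \<eta> z) = 0"
proof -
  define h :: "real^'n \<Rightarrow> real" where "h = indicator (cball 0 2)"
  have h: "integrable lebesgue h" unfolding h_def
    by (intro integrable_real_indicator) (auto intro!: emeasure_bounded_finite[simplified])
  have eq1: "(LINT y|lebesgue. \<eta> (1 *\<^sub>R (y - x)) * h y) = 1" if "x \<in> ball 0 1" for x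
  proof -
    have "(LINT y|lebesgue. \<eta> (1 *\<^sub>R (y - x)) * h y) = (LINT y|lebesgue. \<eta> (y - x))"
    proof (intro Bochner_Integration.integral_cong refl)
      fix y show "\<eta> (1 *\<^sub>R (y - x)) * h y = \<eta> (y - x)"
      proof (cases "y \<in> cball 0 2")
        case False
        then have "y - x \<notin> cball 0 1" using that norm_triangle_sub[of y x] by auto
        then show ?thesis by (simp add: vanishes_off_cball)
      qed (simp add: h_def)
    qed
    also have "\<dots> = (LINT y|lborel. \<eta> (y - x))"
      by (rule integral_completion) measurable
    also have "\<dots> = (LINT z|lborel. \<eta> z)"
      by (subst integral_affine_lborel[where c = 1 and t = x]) auto
    finally show ?thesis using integral_eta by simp
  qed
  have "((\<lambda>x. LINT y|lebesgue. \<eta> (1 *\<^sub>R (y - x)) * h y) has_derivative (\<lambda>v. 0 \<bullet> v)) (at 0)"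
    by (rule has_derivative_transform_within_open[of "\<lambda>_. 1" _ 0 _ "ball 0 1"])
       (use eq1 in \<open>auto simp: h_def\<close>)
  then have "(\<chi> i. - 1 * (LINT y|lebesgue. partial i \<eta> (1 *\<^sub>R (y - 0)) * h y)) = 0"
    using grad_eqI[OF kernel_convolution_has_derivative[OF smooth_eta supp_eta h, of 1 0]]
    by (simp only: grad_eqI)
  then have "(LINT y|lebesgue. partial j \<eta> y * h y) = 0" by (simp add: vec_eq_iff)
  also have "(LINT y|lebesgue. partial j \<eta> y * h y) = (LINT y|lebesgue. partial j \<eta> y)"
    using vanishes_off_cball(3)
    by (intro Bochner_Integration.integral_cong refl) (force simp: h_def indicator_def)
  also have "\<dots> = (LINT y|lborel. partial j \<eta> y)" by (rule integral_completion) measurable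
  finally show ?thesis .
qed

end

lemma mollify_eq_integral_shift:
  fixes k f :: "real^'n \<Rightarrow> real"
  assumes [measurable]: "k \<in> borel_measurable borel" "f \<in> borel_measurable borel" and "0 < \<epsilon>"
  shows "mollify k f \<epsilon> x = (LINT z|lborel. k z * f (x + \<epsilon> *\<^sub>R z))"
proof -
  have "(LINT y|lebesgue. k ((1 / \<epsilon>) *\<^sub>R (y - x)) * f y) = (LINT y|lborel. k ((1 / \<epsilon>) *\<^sub>R (y - x)) * f y)"
    by (rule integral_completion) measurable
  also have "\<dots> = \<epsilon> ^ CARD('n) * (LINT z|lborel. k z * f (x + \<epsilon> *\<^sub>R z))"
    using \<open>0 < \<epsilon>\<close> by (subst integral_affine_lborel[where c = \<epsilon> and t = x]) auto
  finally show ?thesis using \<open>0 < \<epsilon>\<close> by (simp add: mollify_def)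
qed

section \<open>Derivatives of the mollified function\<close>

text \<open>
  The function \<open>\<psi>\<close> has, on a compact set \<open>K\<close>, a weak gradient of unit length, represented by a
  Borel function \<open>g\<close> that is extended by zero. Only the test functions that are rescaled
  translates of \<open>\<eta>\<close> enter the weak derivative. Borel measurability of \<open>g\<close> on the
  whole space gives joint measurability of \<open>g (x + \<epsilon> *\<^sub>R z)\<close> in \<open>x\<close> and \<open>z\<close>, as Tonelli's theorem
  requires; equality with 1 everywhere on \<open>K\<close> avoids exceptional sets in pointwise estimates.
\<close>

locale unit_gradient_mollification = kernel \<eta> for \<eta> :: "real^'n \<Rightarrow> real" +
  fixes \<psi> :: "real^'n \<Rightarrow> real" and g :: "real^'n \<Rightarrow> real^'n" and K :: "(real^'n) set"
  assumes psi_integrable: "integrable lebesgue (\<lambda>y. indicator K y * \<psi> y)"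
    and g_measurable [measurable]: "g \<in> borel_measurable borel"
    and K_compact: "compact K"
    and norm_g_on_K: "\<And>y. y \<in> K \<Longrightarrow> norm (g y) = 1"
    and g_off_K: "\<And>y. y \<notin> K \<Longrightarrow> g y = 0"
    and weak_derivative: "\<And>x \<epsilon> i. 0 < \<epsilon> \<Longrightarrow> cball x \<epsilon> \<subseteq> K \<Longrightarrow>
      (LINT y|lebesgue. (indicator K y * \<psi> y) * partial i (\<lambda>y. \<eta> ((1 / \<epsilon>) *\<^sub>R (y - x))) y)
        = - (LINT y|lebesgue. g y $ i * \<eta> ((1 / \<epsilon>) *\<^sub>R (y - x)))"
begin

lemma norm_g_le_1: "norm (g y) \<le> 1"
  using norm_g_on_K[of y] g_off_K[of y] by (cases "y \<in> K") auto

lemma g_component_le_1: "\<bar>g y $ i\<bar> \<le> 1"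
  using norm_g_le_1[of y] component_le_norm_cart[of "g y" i] by simp

lemma integrable_g_component: "integrable lebesgue (\<lambda>y. g y $ i)"
proof -
  have "integrable lborel (\<lambda>y. indicator K y :: real)"
    using K_compact by (intro integrable_real_indicator)
      (auto intro!: emeasure_bounded_finite[simplified] compact_imp_bounded borel_compact)
  then have "integrable lborel (\<lambda>y. g y $ i)"
    by (rule Bochner_Integration.integrable_bound)
       (use g_component_le_1 g_off_K in \<open>auto simp: indicator_def\<close>)
  then show ?thesis by (subst integrable_completion) auto
qed

text \<open>
  The first derivative is put on the kernel, where it produces a test function whose
  derivative is then moved onto \<open>\<psi>\<close>. The open set \<open>V\<close> provides a neighbourhood of \<open>x\<close> in which
  the mollification sees only the values of \<open>\<psi>\<close> on \<open>K\<close>.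
\<close>

lemma grad_mollify:
  assumes "open V" "x \<in> V" "0 < \<epsilon>" and V: "\<And>x. x \<in> V \<Longrightarrow> cball x \<epsilon> \<subseteq> K"
  shows "grad (mollify \<eta> \<psi> \<epsilon>) x = (\<chi> i. mollify \<eta> (\<lambda>y. g y $ i) \<epsilon> x)"
proof -
  define h where "h y = indicator K y * \<psi> y" for y
  define c where "c = 1 / \<epsilon> ^ CARD('n)"
  have loc: "mollify \<eta> \<psi> \<epsilon> x = c * (LINT y|lebesgue. \<eta> ((1 / \<epsilon>) *\<^sub>R (y - x)) * h y)" if "x \<in> V" for x
  proof -
    have "\<eta> ((1 / \<epsilon>) *\<^sub>R (y - x)) * \<psi> y = \<eta> ((1 / \<epsilon>) *\<^sub>R (y - x)) * h y" for y
    proof (cases "y \<in> cball x \<epsilon>")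
      case True
      then show ?thesis using V[OF that] by (auto simp: h_def)
    next
      case False
      then have "(1 / \<epsilon>) *\<^sub>R (y - x) \<notin> cball 0 1"
        using \<open>0 < \<epsilon>\<close> by (simp only: rescaled_in_unit_cball_iff not_False_eq_True)
      then show ?thesis by (simp add: vanishes_off_cball)
    qed
    then show ?thesis unfolding mollify_def c_def by (simp only:)
  qed
  let ?W = "\<chi> i. - (1 / \<epsilon>) * (LINT y|lebesgue. partial i \<eta> ((1 / \<epsilon>) *\<^sub>R (y - x)) * h y)"
  have "integrable lebesgue h" using psi_integrable by (simp add: h_def[abs_def])
  then have "((\<lambda>x. c * (LINT y|lebesgue. \<eta> ((1 / \<epsilon>) *\<^sub>R (y - x)) * h y)) has_derivative (\<lambda>v. c * (?W \<bullet> v))) (at x)"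
    by (intro has_derivative_mult_right kernel_convolution_has_derivative smooth_eta supp_eta)
  then have "(mollify \<eta> \<psi> \<epsilon> has_derivative (\<lambda>v. c * (?W \<bullet> v))) (at x)"
    by (rule has_derivative_transform_within_open[OF _ assms(1,2)]) (simp add: loc)
  then have "(mollify \<eta> \<psi> \<epsilon> has_derivative (\<lambda>v. (c *\<^sub>R ?W) \<bullet> v)) (at x)" by simp
  then have "grad (mollify \<eta> \<psi> \<epsilon>) x = c *\<^sub>R ?W" by (rule grad_eqI)
  also have "\<dots> = (\<chi> i. mollify \<eta> (\<lambda>y. g y $ i) \<epsilon> x)"
  proof -
    have "partial i (\<lambda>y. \<eta> ((1 / \<epsilon>) *\<^sub>R (y - x))) = (\<lambda>y. (1 / \<epsilon>) * partial i \<eta> ((1 / \<epsilon>) *\<^sub>R (y - x)))" for i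
      using partial_affine(1)[OF smooth_differentiable[OF smooth_eta], of i 1 "1 / \<epsilon>" x] by simp
    then have "- (1 / \<epsilon>) * (LINT y|lebesgue. partial i \<eta> ((1 / \<epsilon>) *\<^sub>R (y - x)) * h y)
        = (LINT y|lebesgue. g y $ i * \<eta> ((1 / \<epsilon>) *\<^sub>R (y - x)))" for i
      using weak_derivative[OF \<open>0 < \<epsilon>\<close> V[OF \<open>x \<in> V\<close>], of i]
      by (simp add: h_def mult_ac)
    then show ?thesis by (simp add: vec_eq_iff mollify_def c_def mult.commute)
  qed
  finally show ?thesis .
qed

definition increment :: "real \<Rightarrow> real^'n \<Rightarrow> real^'n \<Rightarrow> real^'n" where
  "increment \<epsilon> x z = g (x + \<epsilon> *\<^sub>R z) - g x"

definition mean_gradient :: "real \<Rightarrow> real^'n \<Rightarrow> real^'n" where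
  "mean_gradient \<epsilon> x = (LINT z|lborel. \<eta> z *\<^sub>R g (x + \<epsilon> *\<^sub>R z))"

definition mean_hessian :: "real \<Rightarrow> real^'n \<Rightarrow> real^'n^'n" where
  "mean_hessian \<epsilon> x = - (1 / \<epsilon>) *\<^sub>R (LINT z|lborel. outer (increment \<epsilon> x z) (grad \<eta> z))"

lemma increment_measurable [measurable]: "increment \<epsilon> x \<in> borel_measurable borel"
  unfolding increment_def[abs_def] by measurable

lemma norm_increment_le_2: "norm (increment \<epsilon> x z) \<le> 2"
  unfolding increment_def using norm_g_le_1[of x] norm_g_le_1[of "x + \<epsilon> *\<^sub>R z"]
    norm_triangle_ineq4[of "g (x + \<epsilon> *\<^sub>R z)" "g x"] by linarith

lemma grad_mollify_eq_mean_gradient: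
  assumes "open V" "x \<in> V" "0 < \<epsilon>" and V: "\<And>x. x \<in> V \<Longrightarrow> cball x \<epsilon> \<subseteq> K"
  shows "grad (mollify \<eta> \<psi> \<epsilon>) x = mean_gradient \<epsilon> x"
proof -
  have "integrable lborel (\<lambda>z. \<eta> z *\<^sub>R g (x + \<epsilon> *\<^sub>R z))"
    by (rule integrable_eta_mult(1)[where C = 1]) (auto simp: norm_g_le_1)
  then have "mean_gradient \<epsilon> x $ i = mollify \<eta> (\<lambda>y. g y $ i) \<epsilon> x" for i
    using \<open>0 < \<epsilon>\<close> by (simp add: mean_gradient_def integral_vec_nth mollify_eq_integral_shift)
  then show ?thesis by (subst grad_mollify[OF assms]) (simp_all add: vec_eq_iff)
qed

lemma integrable_outer_increment: "integrable lborel (\<lambda>z. outer (increment \<epsilon> x z) (grad \<eta> z))"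
proof -
  obtain B where B: "0 < B" "\<And>z. norm (grad \<eta> z) \<le> B" using kernel_bound by metis
  show ?thesis
  proof (rule integrable_bounded_in_unit_ball[where B = "2 * B"])
    show "norm (outer (increment \<epsilon> x z) (grad \<eta> z)) \<le> 2 * B" for z
      unfolding norm_outer using B norm_increment_le_2 by (intro mult_mono) auto
    show "outer (increment \<epsilon> x z) (grad \<eta> z) = 0" if "z \<notin> cball 0 1" for z
      using vanishes_off_cball(2)[OF that] by (simp add: outer_def vec_eq_iff)
  qed measurable
qed

text \<open>
  The second derivative is again put on the kernel. Since the partial derivatives of \<open>\<eta>\<close>
  have mean zero, the constant \<open>g x\<close> can be subtracted from \<open>g (x + \<epsilon> *\<^sub>R z)\<close>.
\<close>

lemma hessian_mollify_eq_mean_hessian: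
  assumes "open V" "x \<in> V" "0 < \<epsilon>" and V: "\<And>x. x \<in> V \<Longrightarrow> cball x \<epsilon> \<subseteq> K"
  shows "hessian (mollify \<eta> \<psi> \<epsilon>) x = mean_hessian \<epsilon> x"
proof -
  define c where "c = 1 / \<epsilon> ^ CARD('n)"
  define w where "w i = (\<chi> j. - (1 / \<epsilon>) * (LINT y|lebesgue. partial j \<eta> ((1 / \<epsilon>) *\<^sub>R (y - x)) * g y $ i))" for i
  have "((\<lambda>x. c * (LINT y|lebesgue. \<eta> ((1 / \<epsilon>) *\<^sub>R (y - x)) * g y $ i)) has_derivative (\<lambda>v. c * (w i \<bullet> v))) (at x)" for i
    unfolding w_def using integrable_g_component
    by (intro has_derivative_mult_right kernel_convolution_has_derivative smooth_eta supp_eta)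
  then have "(mollify \<eta> (\<lambda>y. g y $ i) \<epsilon> has_derivative (\<lambda>v. c * (w i \<bullet> v))) (at x)" for i
    by (simp add: mollify_def[abs_def] c_def)
  then have "((\<lambda>x. \<chi> i. mollify \<eta> (\<lambda>y. g y $ i) \<epsilon> x) has_derivative (\<lambda>v. \<chi> i. c * (w i \<bullet> v))) (at x)"
    by (subst has_derivative_componentwise_within) (auto simp: Basis_vec_def inner_axis)
  then have D: "(grad (mollify \<eta> \<psi> \<epsilon>) has_derivative (\<lambda>v. \<chi> i. c * (w i \<bullet> v))) (at x)"
    by (rule has_derivative_transform_within_open[OF _ assms(1,2)])
       (use assms in \<open>simp add: grad_mollify\<close>)
  have "hessian (mollify \<eta> \<psi> \<epsilon>) x $ i $ j = c * w i $ j" for i j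
    unfolding hessian_def jacobian_def matrix_def frechet_derivative_at[OF D, symmetric]
    by (simp add: inner_axis)
  moreover have "c * w i $ j = mean_hessian \<epsilon> x $ i $ j" for i j
  proof -
    have int: "integrable lborel (\<lambda>z. partial j \<eta> z * g (x + \<epsilon> *\<^sub>R z) $ i)" "integrable lborel (\<lambda>z. partial j \<eta> z * g x $ i)"
      using integrable_eta_mult(2)[of "\<lambda>z. g (x + \<epsilon> *\<^sub>R z) $ i" 1 j] integrable_eta_mult(2)[of "\<lambda>z. g x $ i" 1 j]
      by (auto simp: g_component_le_1)
    have "c * w i $ j = - (1 / \<epsilon>) * mollify (partial j \<eta>) (\<lambda>y. g y $ i) \<epsilon> x"
      by (simp add: w_def c_def mollify_def)
    also have "mollify (partial j \<eta>) (\<lambda>y. g y $ i) \<epsilon> x = (LINT z|lborel. partial j \<eta> z * g (x + \<epsilon> *\<^sub>R z) $ i)"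
      using \<open>0 < \<epsilon>\<close> by (intro mollify_eq_integral_shift) auto
    also have "\<dots> = (LINT z|lborel. partial j \<eta> z * g (x + \<epsilon> *\<^sub>R z) $ i) - (LINT z|lborel. partial j \<eta> z * g x $ i)"
      using integral_partial_eta[of j] by simp
    also have "\<dots> = (LINT z|lborel. outer (increment \<epsilon> x z) (grad \<eta> z) $ i $ j)"
      by (subst Bochner_Integration.integral_diff[OF int, symmetric])
         (simp add: outer_def increment_def grad_def algebra_simps)
    also have "\<dots> = (LINT z|lborel. outer (increment \<epsilon> x z) (grad \<eta> z)) $ i $ j"
      using integrable_outer_increment[of \<epsilon> x]
      by (simp add: integral_vec_nth integrable_bounded_linear[OF bounded_linear_vec_nth])
    finally show ?thesis by (simp add: mean_hessian_def)
  qed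
  ultimately show ?thesis by (simp add: vec_eq_iff)
qed

lemma norm_mean_hessian_le:
  assumes "0 < \<epsilon>"
  shows "norm (mean_hessian \<epsilon> x) \<le> (1 / \<epsilon>) * (LINT z|lborel. norm (grad \<eta> z) * norm (increment \<epsilon> x z))"
proof -
  have "norm (LINT z|lborel. outer (increment \<epsilon> x z) (grad \<eta> z))
      \<le> (LINT z|lborel. norm (outer (increment \<epsilon> x z) (grad \<eta> z)))"
    by (rule integral_norm_bound)
  then show ?thesis using assms
    by (simp add: mean_hessian_def norm_outer mult.commute divide_right_mono)
qed

text \<open>
  With respect to the probability density \<open>\<eta>\<close>, the vectors \<open>g (x + \<epsilon> *\<^sub>R z)\<close> have unit length and
  mean \<open>mean_gradient \<epsilon> x\<close>. Hence the defect is their variance, which is at most the mean square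
  distance to any fixed vector, in particular to \<open>g x\<close>.
\<close>

lemma defect_bounds:
  assumes "0 < \<epsilon>" "cball x \<epsilon> \<subseteq> K"
  shows "0 \<le> 1 - (norm (mean_gradient \<epsilon> x))\<^sup>2"
    and "1 - (norm (mean_gradient \<epsilon> x))\<^sup>2 \<le> (LINT z|lborel. \<eta> z * (norm (increment \<epsilon> x z))\<^sup>2)"
proof -
  define m where "m = mean_gradient \<epsilon> x"
  define G where "G z = g (x + \<epsilon> *\<^sub>R z)" for z
  have [measurable]: "G \<in> borel_measurable borel" unfolding G_def[abs_def] by measurable
  have G1: "norm (G z) \<le> 1" for z by (simp add: G_def norm_g_le_1)
  have eta_G: "\<eta> z * (norm (G z))\<^sup>2 = \<eta> z" for z
  proof (cases "z \<in> cball 0 1")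
    case True
    then have "x + \<epsilon> *\<^sub>R z \<in> cball x \<epsilon>" using \<open>0 < \<epsilon>\<close> by (simp add: dist_norm mult_left_le)
    then show ?thesis using assms(2) norm_g_on_K by (auto simp: G_def)
  qed (simp add: vanishes_off_cball)
  have int_G: "integrable lborel (\<lambda>z. \<eta> z *\<^sub>R G z)"
    by (rule integrable_eta_mult(1)[where C = 1]) (auto simp: G1)
  have int_inner: "integrable lborel (\<lambda>z. (\<eta> z *\<^sub>R G z) \<bullet> g x)"
    by (rule integrable_inner_left) (rule int_G)
  have int_eta: "integrable lborel \<eta>"
    using integral_eta not_integrable_integral_eq[of lborel \<eta>] by auto
  have "norm m \<le> (LINT z|lborel. norm (\<eta> z *\<^sub>R G z))"
    unfolding m_def mean_gradient_def G_def by (rule integral_norm_bound)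
  also have "\<dots> \<le> (LINT z|lborel. \<eta> z)"
    using integrable_norm[OF int_G] int_eta eta_nonneg G1
    by (intro integral_mono) (auto simp: mult_left_le)
  finally have "norm m \<le> 1" using integral_eta by simp
  then show "0 \<le> 1 - (norm (mean_gradient \<epsilon> x))\<^sup>2"
    unfolding m_def[symmetric] using power_le_one[of "norm m" 2] by simp
  have pt: "\<eta> z * (norm (increment \<epsilon> x z))\<^sup>2
      = \<eta> z - 2 * ((\<eta> z *\<^sub>R G z) \<bullet> g x) + (norm (g x))\<^sup>2 * \<eta> z" for z
  proof -
    have expand: "(norm (increment \<epsilon> x z))\<^sup>2 = (norm (G z))\<^sup>2 - 2 * (G z \<bullet> g x) + (norm (g x))\<^sup>2"
      by (simp add: increment_def G_def power2_norm_eq_inner inner_diff inner_commute)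
    have "\<eta> z * (norm (increment \<epsilon> x z))\<^sup>2
        = \<eta> z * (norm (G z))\<^sup>2 - 2 * (\<eta> z * (G z \<bullet> g x)) + (norm (g x))\<^sup>2 * \<eta> z"
      unfolding expand by (simp add: algebra_simps)
    then show ?thesis unfolding eta_G by simp
  qed
  have "(LINT z|lborel. (\<eta> z *\<^sub>R G z) \<bullet> g x) = m \<bullet> g x"
    using integral_inner_left[OF int_G, of "g x"] by (simp add: m_def mean_gradient_def G_def)
  then have "(LINT z|lborel. \<eta> z * (norm (increment \<epsilon> x z))\<^sup>2) = 1 - 2 * (m \<bullet> g x) + (norm (g x))\<^sup>2"
    unfolding pt using int_inner int_eta integral_eta by simp
  also have "\<dots> = 1 - (norm m)\<^sup>2 + (norm (m - g x))\<^sup>2"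
    by (simp add: power2_norm_eq_inner inner_diff inner_commute)
  finally show "1 - (norm (mean_gradient \<epsilon> x))\<^sup>2 \<le> (LINT z|lborel. \<eta> z * (norm (increment \<epsilon> x z))\<^sup>2)"
    by (simp add: m_def)
qed

end

section \<open>Pointwise bounds by the local energy\<close>

lemma integrable_weighted_powr:
  fixes k :: "'a::euclidean_space \<Rightarrow> real"
  assumes [measurable]: "k \<in> borel_measurable borel"
    and k: "\<And>z. 0 \<le> k z" "\<And>z. k z \<le> B" "\<And>z. z \<notin> cball 0 1 \<Longrightarrow> k z = 0"
    and "0 \<le> a" "0 \<le> s"
  shows "integrable lborel (\<lambda>z. norm z powr a * k z powr s)"
proof (rule integrable_bounded_in_unit_ball[where B = "1 * B powr s"])
  show "norm (norm z powr a * k z powr s) \<le> 1 * B powr s" for z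
  proof (cases "z \<in> cball 0 1")
    case True
    then have "norm z powr a \<le> 1" using \<open>0 \<le> a\<close> by (intro powr_le1) auto
    moreover have "k z powr s \<le> B powr s" using k \<open>0 \<le> s\<close> by (intro powr_mono2) auto
    ultimately have "norm z powr a * k z powr s \<le> 1 * B powr s" by (intro mult_mono) auto
    then show ?thesis by simp
  qed (simp add: k)
qed (simp_all add: k)

context unit_gradient_mollification
begin

text \<open>
  The inner integral of the functional \<open>A_lim\<close> at the point \<open>x\<close>, after the substitution
  \<open>y = x + \<epsilon> *\<^sub>R z\<close>.
\<close>

definition local_energy :: "real \<Rightarrow> real \<Rightarrow> real^'n \<Rightarrow> ennreal" where
  "local_energy r \<epsilon> x = (\<integral>\<^sup>+z\<in>ball 0 1. ennreal (1 / (\<epsilon> * norm z) * norm (increment \<epsilon> x z) powr r) \<partial>lborel)"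

lemma ball_borel [measurable]: "ball a e \<in> sets borel" for a :: "real^'n"
  by simp

lemma local_energy_eq:
  assumes "0 < \<epsilon>"
  shows "local_energy r \<epsilon> x = ennreal (1 / \<epsilon>) * (\<integral>\<^sup>+z\<in>ball 0 1. ennreal (norm (increment \<epsilon> x z) powr r / norm z) \<partial>lborel)"
proof -
  have "ennreal (1 / (\<epsilon> * norm z) * norm (increment \<epsilon> x z) powr r) * indicator (ball 0 1) z
      = ennreal (1 / \<epsilon>) * (ennreal (norm (increment \<epsilon> x z) powr r / norm z) * indicator (ball 0 1) z)" for z
    using assms by (simp add: indicator_def flip: ennreal_mult)
  then show ?thesis unfolding local_energy_def by (simp add: nn_integral_cmult)
qed

text \<open>
  The norm of an outer product is the product of the norms, so the Hessian is bounded by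
  \<open>1 / \<epsilon>\<close> times the integral of \<open>norm (grad \<eta> z) * norm (increment \<epsilon> x z)\<close>. The weighted Hoelder
  inequality with exponent \<open>q\<close> finishes the estimate, and of the powers of \<open>\<epsilon>\<close> there remains
  \<open>\<epsilon> powr (q - 1) / \<epsilon> powr q = 1 / \<epsilon>\<close>.
\<close>

lemma hessian_bound:
  assumes "1 < q" "0 < \<epsilon>"
  shows "ennreal (\<epsilon> powr (q - 1) * norm (mean_hessian \<epsilon> x) powr q)
    \<le> ennreal (hessian_const \<eta> q) * local_energy q \<epsilon> x"
proof -
  define I where "I = (LINT z|lborel. norm (grad \<eta> z) * norm (increment \<epsilon> x z))"
  obtain B where B: "0 < B" "\<And>z. norm (grad \<eta> z) \<le> B" using kernel_bound by metis
  have int: "integrable lborel (\<lambda>z. norm (grad \<eta> z) * norm (increment \<epsilon> x z))"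
    using integrable_eta_mult(3)[of "\<lambda>z. norm (increment \<epsilon> x z)" 2] norm_increment_le_2 by simp
  have const: "hessian_const \<eta> q
      = (LINT z|lborel. norm z powr (1 / (q - 1)) * norm (grad \<eta> z) powr (q / (q - 1))) powr (q - 1)"
    unfolding hessian_const_def by (subst integral_completion) measurable
  have "\<epsilon> powr (q - 1) * norm (mean_hessian \<epsilon> x) powr q \<le> \<epsilon> powr (q - 1) * (1 / \<epsilon> * I) powr q"
    using norm_mean_hessian_le[OF \<open>0 < \<epsilon>\<close>, of x] \<open>1 < q\<close>
    by (intro mult_left_mono powr_mono2) (auto simp: I_def)
  also have "\<dots> = 1 / \<epsilon> * I powr q"
  proof -
    have "0 \<le> I" unfolding I_def by (intro integral_nonneg_AE) auto
    then have "(1 / \<epsilon> * I) powr q = I powr q / \<epsilon> powr q"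
      using \<open>0 < \<epsilon>\<close> by (simp add: powr_divide)
    then show ?thesis using \<open>0 < \<epsilon>\<close> by (simp add: powr_diff)
  qed
  finally have "ennreal (\<epsilon> powr (q - 1) * norm (mean_hessian \<epsilon> x) powr q) \<le> ennreal (1 / \<epsilon>) * ennreal (I powr q)"
    using \<open>0 < \<epsilon>\<close> by (simp add: ennreal_leI flip: ennreal_mult)
  also have "\<dots> \<le> ennreal (1 / \<epsilon>) * (ennreal (hessian_const \<eta> q)
      * (\<integral>\<^sup>+z\<in>ball 0 1. ennreal (norm (increment \<epsilon> x z) powr q / norm z) \<partial>lborel))"
    unfolding const I_def using \<open>1 < q\<close> B vanishes_off_unit_ball(2) vanishes_off_cball(2) int
    by (intro mult_left_mono weighted_hoelder_unit_ball integrable_weighted_powr[where B = B]) auto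
  finally show ?thesis by (simp add: local_energy_eq[OF \<open>0 < \<epsilon>\<close>] mult.left_commute)
qed

lemma norm_times_eta_le_defect_const: "norm z * \<eta> z \<le> defect_const \<eta> 2"
proof -
  obtain B where B: "0 < B" "\<And>z. \<eta> z \<le> B" using kernel_bound by metis
  have "norm z * \<bar>\<eta> z\<bar> \<le> 1 * B" for z
    using B eta_nonneg[of z] vanishes_off_cball(1)[of z] mult_mono[of "norm z" 1 "\<eta> z" B]
    by (cases "z \<in> cball 0 1") auto
  then have "bdd_above (range (\<lambda>z. norm z * \<bar>\<eta> z\<bar>))" by (intro bdd_aboveI2)
  then have "norm z * \<bar>\<eta> z\<bar> \<le> (SUP z. norm z * \<bar>\<eta> z\<bar>)" by (rule cSUP_upper[OF UNIV_I])
  then show ?thesis using eta_nonneg by (simp add: defect_const_def)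
qed

text \<open>
  The variance bound is followed by the weighted Hoelder inequality with exponent \<open>p / 2\<close>. For
  \<open>p = 2\<close> this exponent is 1, and the supremum of \<open>norm z * \<bar>\<eta> z\<bar>\<close> takes the place of the dual norm.
\<close>

lemma defect_bound:
  assumes "2 \<le> p" "0 < \<epsilon>" "cball x \<epsilon> \<subseteq> K"
  shows "ennreal (1 / \<epsilon> * (1 - (norm (mean_gradient \<epsilon> x))\<^sup>2) powr (p / 2))
    \<le> ennreal (defect_const \<eta> p) * local_energy p \<epsilon> x"
proof -
  define I where "I = (LINT z|lborel. \<eta> z * (norm (increment \<epsilon> x z))\<^sup>2)"
  define J where "J = (\<integral>\<^sup>+z\<in>ball 0 1. ennreal (norm (increment \<epsilon> x z) powr p / norm z) \<partial>lborel)"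
  obtain B where B: "0 < B" "\<And>z. \<eta> z \<le> B" using kernel_bound by metis
  have "(norm (increment \<epsilon> x z))\<^sup>2 \<le> 2\<^sup>2" for z
    using norm_increment_le_2 by (intro power_mono) auto
  then have int: "integrable lborel (\<lambda>z. \<eta> z * (norm (increment \<epsilon> x z))\<^sup>2)"
    using integrable_eta_mult(1)[of "\<lambda>z. (norm (increment \<epsilon> x z))\<^sup>2" "2\<^sup>2"] by simp
  have "ennreal (I powr (p / 2)) \<le> ennreal (defect_const \<eta> p) * J"
  proof (cases "p = 2")
    case True
    have "ennreal I = (\<integral>\<^sup>+z. ennreal (\<eta> z * (norm (increment \<epsilon> x z))\<^sup>2) \<partial>lborel)"
      unfolding I_def using int eta_nonneg by (intro nn_integral_eq_integral[symmetric]) auto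
    also have "\<dots> \<le> (\<integral>\<^sup>+z. ennreal (defect_const \<eta> 2)
        * (ennreal (norm (increment \<epsilon> x z) powr p / norm z) * indicator (ball 0 1) z) \<partial>lborel)"
    proof (rule nn_integral_mono_AE)
      show "AE z in lborel. ennreal (\<eta> z * (norm (increment \<epsilon> x z))\<^sup>2)
        \<le> ennreal (defect_const \<eta> 2) * (ennreal (norm (increment \<epsilon> x z) powr p / norm z) * indicator (ball 0 1) z)"
        using AE_lborel_singleton[of 0]
      proof eventually_elim
        case (elim z)
        let ?d = "(norm (increment \<epsilon> x z))\<^sup>2"
        have "\<eta> z * ?d = (norm z * \<eta> z) * (?d / norm z)" using elim by simp
        also have "\<dots> \<le> defect_const \<eta> 2 * (?d / norm z)"
          by (intro mult_right_mono norm_times_eta_le_defect_const) auto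
        finally have "\<eta> z * ?d \<le> defect_const \<eta> 2 * (?d / norm z)" .
        moreover have "0 \<le> defect_const \<eta> 2"
          using norm_times_eta_le_defect_const[of 0] by simp
        ultimately show ?case using True vanishes_off_unit_ball(1)[of z]
          by (cases "z \<in> ball 0 1") (auto simp: ennreal_leI simp flip: ennreal_mult)
      qed
    qed
    also have "\<dots> = ennreal (defect_const \<eta> 2) * J"
      unfolding J_def by (rule nn_integral_cmult) measurable
    finally show ?thesis using True eta_nonneg by (simp add: I_def)
  next
    case False
    then have p: "1 < p / 2" using \<open>2 \<le> p\<close> by simp
    have exps: "1 / (p / 2 - 1) = 2 / (p - 2)" "p / 2 / (p / 2 - 1) = p / (p - 2)" "p / 2 - 1 = (p - 2) / 2"
      using False by (auto simp: field_simps)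
    have const: "defect_const \<eta> p = (LINT z|lborel. norm z powr (2 / (p - 2)) * \<eta> z powr (p / (p - 2))) powr ((p - 2) / 2)"
      unfolding defect_const_def using False eta_nonneg by (simp, subst integral_completion) measurable
    have "(norm (increment \<epsilon> x z))\<^sup>2 powr (p / 2) = norm (increment \<epsilon> x z) powr p" for z
      by (simp add: powr_powr flip: powr_numeral)
    then show ?thesis
      using weighted_hoelder_unit_ball[of "p / 2" \<eta> "\<lambda>z. (norm (increment \<epsilon> x z))\<^sup>2"]
        p B eta_nonneg vanishes_off_unit_ball(1) vanishes_off_cball(1) int
        integrable_weighted_powr[of \<eta> B "2 / (p - 2)" "p / (p - 2)"]
      unfolding exps const I_def J_def by simp
  qed
  note Hoelder = this
  have "ennreal (1 / \<epsilon> * (1 - (norm (mean_gradient \<epsilon> x))\<^sup>2) powr (p / 2)) \<le> ennreal (1 / \<epsilon> * I powr (p / 2))"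
    using defect_bounds[OF assms(2,3)] assms(1,2) unfolding I_def[symmetric]
    by (intro ennreal_leI mult_left_mono powr_mono2) auto
  also have "\<dots> = ennreal (1 / \<epsilon>) * ennreal (I powr (p / 2))"
    using assms(2) by (simp flip: ennreal_mult)
  also have "\<dots> \<le> ennreal (1 / \<epsilon>) * (ennreal (defect_const \<eta> p) * J)"
    using Hoelder by (rule mult_left_mono) simp
  finally show ?thesis by (simp add: local_energy_eq[OF \<open>0 < \<epsilon>\<close>] mult.left_commute J_def)
qed

lemma measurable_local_energy [measurable]: "local_energy r \<epsilon> \<in> borel_measurable borel"
  unfolding local_energy_def[abs_def] increment_def by measurable

lemma measurable_mean_gradient [measurable]: "mean_gradient \<epsilon> \<in> borel_measurable borel"
  unfolding mean_gradient_def[abs_def] by measurable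

lemma measurable_mean_hessian [measurable]: "mean_hessian \<epsilon> \<in> borel_measurable borel"
  unfolding mean_hessian_def[abs_def] increment_def by measurable

end

section \<open>Integrated bounds and forms of the energy\<close>

context unit_gradient_mollification
begin

definition energy :: "real \<Rightarrow> real \<Rightarrow> (real^'n) set \<Rightarrow> ennreal" where
  "energy r \<epsilon> S = (\<integral>\<^sup>+x\<in>S. local_energy r \<epsilon> x \<partial>lborel)"

context
  fixes \<epsilon> :: real and S V :: "(real^'n) set"
  assumes eps: "0 < \<epsilon>" and V: "open V" "\<And>x. x \<in> V \<Longrightarrow> cball x \<epsilon> \<subseteq> K"
    and S [measurable]: "S \<in> sets borel" and SV: "S \<subseteq> V"
begin

lemma on_S:
  assumes "x \<in> S"
  shows "grad (mollify \<eta> \<psi> \<epsilon>) x = mean_gradient \<epsilon> x"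
    and "hessian (mollify \<eta> \<psi> \<epsilon>) x = mean_hessian \<epsilon> x"
    and "cball x \<epsilon> \<subseteq> K"
  using assms SV V eps
  by (auto intro!: grad_mollify_eq_mean_gradient[of V] hessian_mollify_eq_mean_hessian[of V])

lemma total_bound:
  assumes "1 < q" "2 \<le> p"
  shows "(\<integral>\<^sup>+x\<in>S. ennreal (\<epsilon> powr (q - 1) * norm (hessian (mollify \<eta> \<psi> \<epsilon>) x) powr q
        + 1 / \<epsilon> * (1 - (norm (grad (mollify \<eta> \<psi> \<epsilon>) x))\<^sup>2) powr (p / 2)) \<partial>lebesgue)
    \<le> ennreal (hessian_const \<eta> q) * energy q \<epsilon> S + ennreal (defect_const \<eta> p) * energy p \<epsilon> S"
proof -
  have "(\<integral>\<^sup>+x\<in>S. ennreal (\<epsilon> powr (q - 1) * norm (hessian (mollify \<eta> \<psi> \<epsilon>) x) powr q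
        + 1 / \<epsilon> * (1 - (norm (grad (mollify \<eta> \<psi> \<epsilon>) x))\<^sup>2) powr (p / 2)) \<partial>lborel)
    \<le> (\<integral>\<^sup>+x. ennreal (hessian_const \<eta> q) * (local_energy q \<epsilon> x * indicator S x)
        + ennreal (defect_const \<eta> p) * (local_energy p \<epsilon> x * indicator S x) \<partial>lborel)"
    using hessian_bound[OF assms(1) eps] defect_bound[OF assms(2) eps] eps
    by (intro nn_integral_mono) (auto simp: indicator_def on_S intro!: add_mono)
  also have "\<dots> = ennreal (hessian_const \<eta> q) * energy q \<epsilon> S + ennreal (defect_const \<eta> p) * energy p \<epsilon> S"
    unfolding energy_def by (simp add: nn_integral_add nn_integral_cmult)
  finally show ?thesis by (simp add: nn_integral_completion)
qed

lemma integral_of_sum: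
  "(\<integral>\<^sup>+x\<in>S. ennreal (\<epsilon> powr (q - 1) * norm (hessian (mollify \<eta> \<psi> \<epsilon>) x) powr q
      + 1 / \<epsilon> * (1 - (norm (grad (mollify \<eta> \<psi> \<epsilon>) x))\<^sup>2) powr (p / 2)) \<partial>lebesgue)
   = (\<integral>\<^sup>+x\<in>S. ennreal (\<epsilon> powr (q - 1) * norm (hessian (mollify \<eta> \<psi> \<epsilon>) x) powr q) \<partial>lebesgue)
    + (\<integral>\<^sup>+x\<in>S. ennreal (1 / \<epsilon> * (1 - (norm (grad (mollify \<eta> \<psi> \<epsilon>) x))\<^sup>2) powr (p / 2)) \<partial>lebesgue)"
proof -
  define a where "a x = \<epsilon> powr (q - 1) * norm (mean_hessian \<epsilon> x) powr q" for x
  define b where "b x = 1 / \<epsilon> * (1 - (norm (mean_gradient \<epsilon> x))\<^sup>2) powr (p / 2)" for x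
  have [measurable]: "a \<in> borel_measurable borel" "b \<in> borel_measurable borel"
    unfolding a_def[abs_def] b_def[abs_def] by measurable
  have ab: "ennreal (\<epsilon> powr (q - 1) * norm (hessian (mollify \<eta> \<psi> \<epsilon>) x) powr q) * indicator S x = ennreal (a x) * indicator S x"
    "ennreal (1 / \<epsilon> * (1 - (norm (grad (mollify \<eta> \<psi> \<epsilon>) x))\<^sup>2) powr (p / 2)) * indicator S x = ennreal (b x) * indicator S x"
    "ennreal (\<epsilon> powr (q - 1) * norm (hessian (mollify \<eta> \<psi> \<epsilon>) x) powr q
      + 1 / \<epsilon> * (1 - (norm (grad (mollify \<eta> \<psi> \<epsilon>) x))\<^sup>2) powr (p / 2)) * indicator S x
      = ennreal (a x) * indicator S x + ennreal (b x) * indicator S x" for x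
    using eps by (auto simp: indicator_def on_S a_def b_def)
  show ?thesis unfolding ab nn_integral_completion
    by (rule nn_integral_add) measurable
qed

text \<open>
  This is Young's inequality with exponents 3 and 3/2, applied at each point.
\<close>

lemma product_bound:
  "ennreal (3 / root 3 4) * (\<integral>\<^sup>+x\<in>S. ennreal (norm (hessian (mollify \<eta> \<psi> \<epsilon>) x)
      * \<bar>1 - (norm (grad (mollify \<eta> \<psi> \<epsilon>) x))\<^sup>2\<bar>) \<partial>lebesgue)
   \<le> (\<integral>\<^sup>+x\<in>S. ennreal (\<epsilon> powr (3 - 1) * norm (hessian (mollify \<eta> \<psi> \<epsilon>) x) powr 3
      + 1 / \<epsilon> * (1 - (norm (grad (mollify \<eta> \<psi> \<epsilon>) x))\<^sup>2) powr (3 / 2)) \<partial>lebesgue)"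
proof -
  define h where "h x = norm (mean_hessian \<epsilon> x)" for x
  define d where "d x = 1 - (norm (mean_gradient \<epsilon> x))\<^sup>2" for x
  have [measurable]: "h \<in> borel_measurable borel" "d \<in> borel_measurable borel"
    unfolding h_def[abs_def] d_def[abs_def] by measurable
  have d0: "0 \<le> d x" if "x \<in> S" for x
    using defect_bounds(1)[OF eps on_S(3)[OF that]] by (simp add: d_def)
  have young: "3 / root 3 4 * (s * t) \<le> \<epsilon> powr (3 - 1) * s powr 3 + 1 / \<epsilon> * t powr (3 / 2)"
    if "0 \<le> s" "0 \<le> t" for s t
  proof -
    \<comment> \<open>the factors make \<open>a powr 3 / 3\<close> and \<open>b powr (3 / 2) / (3 / 2)\<close> the two summands of the bound,
      while the powers of \<open>\<epsilon>\<close> cancel in \<open>a * b\<close>\<close>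
    define a where "a = (3 powr (1 / 3)) * \<epsilon> powr (2 / 3) * s"
    define b where "b = ((3 / 2) powr (2 / 3)) * \<epsilon> powr (- 2 / 3) * t"
    have ab: "0 \<le> a" "0 \<le> b" using that by (auto simp: a_def b_def)
    have "a * b \<le> a powr 3 / 3 + b powr (3 / 2) / (3 / 2)"
      using ab by (intro Youngs_inequality) auto
    also have "a powr 3 = 3 * \<epsilon> powr 2 * s powr 3"
      using eps that by (simp add: a_def powr_mult powr_powr)
    also have "b powr (3 / 2) = (3 / 2) * \<epsilon> powr (- 1) * t powr (3 / 2)"
      using eps that by (simp add: b_def powr_mult powr_powr)
    finally have "a * b \<le> \<epsilon> powr 2 * s powr 3 + 1 / \<epsilon> * t powr (3 / 2)"
      using eps by (simp add: powr_minus field_simps)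
    moreover have "a * b = (3 powr (1 / 3) * (3 / 2) powr (2 / 3)) * (\<epsilon> powr (2 / 3) * \<epsilon> powr (- 2 / 3)) * (s * t)"
      by (simp add: a_def b_def mult_ac)
    moreover have "\<epsilon> powr (2 / 3) * \<epsilon> powr (- 2 / 3) = 1"
      using eps by (simp flip: powr_add)
    moreover have "3 powr (1 / 3) * (3 / 2) powr (2 / 3) = 3 / root 3 (4::real)"
    proof -
      have "(3::real) powr (1 / 3) * 3 powr (2 / 3) = 3" by (simp flip: powr_add)
      moreover have "(2::real) powr (2 / 3) = root 3 4"
        using powr_powr[of "2::real" 2 "1 / 3"] by (simp add: root_powr_inverse)
      ultimately show ?thesis by (simp add: powr_divide)
    qed
    ultimately show ?thesis by simp
  qed
  have eq: "ennreal (norm (hessian (mollify \<eta> \<psi> \<epsilon>) x) * \<bar>1 - (norm (grad (mollify \<eta> \<psi> \<epsilon>) x))\<^sup>2\<bar>) * indicator S x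
      = ennreal (h x * \<bar>d x\<bar>) * indicator S x" for x
    by (auto simp: indicator_def on_S h_def d_def)
  have "ennreal (3 / root 3 4) * (\<integral>\<^sup>+x\<in>S. ennreal (h x * \<bar>d x\<bar>) \<partial>lborel)
      = (\<integral>\<^sup>+x. ennreal (3 / root 3 4) * (ennreal (h x * \<bar>d x\<bar>) * indicator S x) \<partial>lborel)"
    by (rule nn_integral_cmult[symmetric]) measurable
  also have "\<dots> \<le> (\<integral>\<^sup>+x\<in>S. ennreal (\<epsilon> powr (3 - 1) * norm (hessian (mollify \<eta> \<psi> \<epsilon>) x) powr 3
      + 1 / \<epsilon> * (1 - (norm (grad (mollify \<eta> \<psi> \<epsilon>) x))\<^sup>2) powr (3 / 2)) \<partial>lborel)"
  proof (intro nn_integral_mono)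
    fix x
    show "ennreal (3 / root 3 4) * (ennreal (h x * \<bar>d x\<bar>) * indicator S x)
      \<le> ennreal (\<epsilon> powr (3 - 1) * norm (hessian (mollify \<eta> \<psi> \<epsilon>) x) powr 3
      + 1 / \<epsilon> * (1 - (norm (grad (mollify \<eta> \<psi> \<epsilon>) x))\<^sup>2) powr (3 / 2)) * indicator S x"
    proof (cases "x \<in> S")
      case True
      have "ennreal (3 / root 3 4) * ennreal (h x * \<bar>d x\<bar>) = ennreal (3 / root 3 4 * (h x * \<bar>d x\<bar>))"
        by (rule ennreal_mult'[symmetric]) simp
      also have "\<dots> \<le> ennreal (\<epsilon> powr (3 - 1) * h x powr 3 + 1 / \<epsilon> * d x powr (3 / 2))"
        using young[of "h x" "d x"] d0[OF True] by (intro ennreal_leI) (simp add: h_def)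
      finally show ?thesis using True by (simp add: on_S h_def d_def)
    qed simp
  qed
  finally show ?thesis by (simp only: eq nn_integral_completion)
qed

text \<open>
  For each fixed \<open>z\<close> the translate of a null set is null, so \<open>D\<psi>\<close> may be replaced by \<open>g\<close> in the
  integral over \<open>x\<close>; Tonelli's theorem then exchanges the two integrals.
\<close>

lemma energy_eq_shift:
  assumes Dpsi: "AE y in lborel. y \<in> K \<longrightarrow> D\<psi> y = g y"
  shows "(\<integral>\<^sup>+z\<in>ball 0 1. (\<integral>\<^sup>+x\<in>S.
     ennreal (1 / (\<epsilon> * norm z) * norm (D\<psi> (x + \<epsilon> *\<^sub>R z) - D\<psi> x) ^ 3) \<partial>lebesgue) \<partial>lebesgue) = energy 3 \<epsilon> S"
proof -
  define F where "F x z = ennreal (1 / (\<epsilon> * norm z) * norm (increment \<epsilon> x z) powr 3) * indicator (ball 0 1) z * indicator S x" for x z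
  have [measurable]: "(\<lambda>(x, z). F x z) \<in> borel_measurable (lborel \<Otimes>\<^sub>M lborel)"
    unfolding F_def increment_def by measurable
  have inner: "(\<integral>\<^sup>+x\<in>S. ennreal (1 / (\<epsilon> * norm z) * norm (D\<psi> (x + \<epsilon> *\<^sub>R z) - D\<psi> x) ^ 3) \<partial>lebesgue) * indicator (ball 0 1) z
      = (\<integral>\<^sup>+x. F x z \<partial>lborel)" for z
  proof (cases "z \<in> ball 0 1")
    case True
    have "AE x in lborel. x + \<epsilon> *\<^sub>R z \<in> K \<longrightarrow> D\<psi> (x + \<epsilon> *\<^sub>R z) = g (x + \<epsilon> *\<^sub>R z)"
      using AE_affine_lborel[OF _ Dpsi, of 1 "\<epsilon> *\<^sub>R z"] by (simp add: add.commute)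
    with Dpsi have "AE x in lborel. ennreal (1 / (\<epsilon> * norm z) * norm (D\<psi> (x + \<epsilon> *\<^sub>R z) - D\<psi> x) ^ 3) * indicator S x = F x z"
    proof eventually_elim
      case (elim x)
      show ?case
      proof (cases "x \<in> S")
        case xS: True
        have "x \<in> cball x \<epsilon>" "x + \<epsilon> *\<^sub>R z \<in> cball x \<epsilon>"
          using eps True by (auto simp: dist_norm mult_left_le)
        then have "x \<in> K" "x + \<epsilon> *\<^sub>R z \<in> K" using on_S(3)[OF xS] by auto
        then have "D\<psi> (x + \<epsilon> *\<^sub>R z) - D\<psi> x = increment \<epsilon> x z"
          using elim by (simp add: increment_def)
        then show ?thesis using xS True by (simp add: F_def)
      qed (simp add: F_def)
    qed
    then show ?thesis using True by (simp add: nn_integral_completion cong: nn_integral_cong_AE)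
  qed (simp add: F_def)
  have "(\<integral>\<^sup>+z. (\<integral>\<^sup>+x. F x z \<partial>lborel) \<partial>lborel) = (\<integral>\<^sup>+x. (\<integral>\<^sup>+z. F x z \<partial>lborel) \<partial>lborel)"
    by (rule lborel_pair.Fubini') measurable
  also have "\<dots> = energy 3 \<epsilon> S"
    unfolding energy_def local_energy_def F_def
    by (intro nn_integral_cong nn_integral_multc) measurable
  finally show ?thesis unfolding inner by (simp only: nn_integral_completion)
qed

lemma energy_eq_difference_quotient:
  assumes Dpsi: "AE y in lborel. y \<in> K \<longrightarrow> D\<psi> y = g y"
  shows "(\<integral>\<^sup>+x\<in>S. (\<integral>\<^sup>+y\<in>ball x \<epsilon>.
     ennreal (1 / \<epsilon> ^ CARD('n) * (norm (D\<psi> y - D\<psi> x) powr r / norm (y - x))) \<partial>lebesgue) \<partial>lebesgue) = energy r \<epsilon> S"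
proof -
  have "(\<integral>\<^sup>+y\<in>ball x \<epsilon>. ennreal (1 / \<epsilon> ^ CARD('n) * (norm (D\<psi> y - D\<psi> x) powr r / norm (y - x))) \<partial>lebesgue)
      = local_energy r \<epsilon> x" if x: "x \<in> S" "x \<in> K \<longrightarrow> D\<psi> x = g x" for x
  proof -
    have "x \<in> K" "ball x \<epsilon> \<subseteq> K"
      using subsetD[OF on_S(3)[OF x(1)], of x] on_S(3)[OF x(1)] eps ball_subset_cball by auto
    then have "ball x \<epsilon> \<subseteq> K" "D\<psi> x = g x" using x by auto
    with Dpsi have "AE y in lborel. ennreal (1 / \<epsilon> ^ CARD('n) * (norm (D\<psi> y - D\<psi> x) powr r / norm (y - x))) * indicator (ball x \<epsilon>) y
        = ennreal (1 / \<epsilon> ^ CARD('n) * (norm (g y - g x) powr r / norm (y - x))) * indicator (ball x \<epsilon>) y"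
      by (auto simp: indicator_def elim!: eventually_mono)
    then have "(\<integral>\<^sup>+y\<in>ball x \<epsilon>. ennreal (1 / \<epsilon> ^ CARD('n) * (norm (D\<psi> y - D\<psi> x) powr r / norm (y - x))) \<partial>lebesgue)
      = (\<integral>\<^sup>+y\<in>ball x \<epsilon>. ennreal (1 / \<epsilon> ^ CARD('n) * (norm (g y - g x) powr r / norm (y - x))) \<partial>lborel)"
      unfolding nn_integral_completion by (rule nn_integral_cong_AE)
    also have "\<dots> = ennreal (\<bar>\<epsilon>\<bar> ^ DIM(real^'n)) * (\<integral>\<^sup>+z. ennreal (1 / \<epsilon> ^ CARD('n) *
        (norm (g (x + \<epsilon> *\<^sub>R z) - g x) powr r / norm (x + \<epsilon> *\<^sub>R z - x))) * indicator (ball x \<epsilon>) (x + \<epsilon> *\<^sub>R z) \<partial>lborel)"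
      using eps by (intro nn_integral_affine_lborel) auto
    also have "\<dots> = (\<integral>\<^sup>+z. ennreal (\<bar>\<epsilon>\<bar> ^ DIM(real^'n)) * (ennreal (1 / \<epsilon> ^ CARD('n) *
        (norm (g (x + \<epsilon> *\<^sub>R z) - g x) powr r / norm (x + \<epsilon> *\<^sub>R z - x))) * indicator (ball x \<epsilon>) (x + \<epsilon> *\<^sub>R z)) \<partial>lborel)"
      by (rule nn_integral_cmult[symmetric]) measurable
    also have "\<dots> = local_energy r \<epsilon> x"
      unfolding local_energy_def
    proof (rule nn_integral_cong)
      fix z :: "real^'n"
      have ind: "indicator (ball x \<epsilon>) (x + \<epsilon> *\<^sub>R z) = (indicator (ball 0 1) z :: ennreal)"
        using eps by (simp add: indicator_def dist_norm)
      show "ennreal (\<bar>\<epsilon>\<bar> ^ DIM(real^'n)) * (ennreal (1 / \<epsilon> ^ CARD('n) *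
          (norm (g (x + \<epsilon> *\<^sub>R z) - g x) powr r / norm (x + \<epsilon> *\<^sub>R z - x))) * indicator (ball x \<epsilon>) (x + \<epsilon> *\<^sub>R z))
        = ennreal (1 / (\<epsilon> * norm z) * norm (increment \<epsilon> x z) powr r) * indicator (ball 0 1) z"
        unfolding ind mult.assoc[symmetric] using eps
        by (simp add: increment_def flip: ennreal_mult)
    qed
    finally show ?thesis .
  qed
  then have "AE x in lborel. (\<integral>\<^sup>+y\<in>ball x \<epsilon>.
      ennreal (1 / \<epsilon> ^ CARD('n) * (norm (D\<psi> y - D\<psi> x) powr r / norm (y - x))) \<partial>lebesgue) * indicator S x
      = local_energy r \<epsilon> x * indicator S x"
    using Dpsi by (auto simp: indicator_def elim!: eventually_mono)
  then show ?thesis unfolding energy_def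
    by (subst nn_integral_completion) (rule nn_integral_cong_AE)
qed

end
end

section \<open>Passage from the weak gradient to a Borel representative\<close>

lemma borel_unit_representative:
  fixes v :: "real^'n \<Rightarrow> real^'n"
  assumes v: "v absolutely_integrable_on K" and K: "compact K"
    and unit: "AE y in lborel. y \<in> K \<longrightarrow> norm (v y) = 1"
  obtains g where "g \<in> borel_measurable borel" "\<And>y. y \<in> K \<Longrightarrow> norm (g y) = 1" "\<And>y. y \<notin> K \<Longrightarrow> g y = 0"
    "AE y in lborel. y \<in> K \<longrightarrow> v y = g y"
proof -
  have K_borel [measurable]: "K \<in> sets borel" using K by (rule borel_compact)
  have meas: "(\<lambda>y. indicator K y *\<^sub>R v y) \<in> borel_measurable lebesgue"
    using v by (auto simp: set_integrable_def)
  have "\<exists>h\<in>borel_measurable lborel. AE y in lborel. (indicator K y *\<^sub>R v y) $ i = h y" for i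
    by (intro completion_ex_borel_measurable_real borel_measurable_vec_nth meas)
  then have "\<forall>i. \<exists>h. h \<in> borel_measurable lborel \<and> (AE y in lborel. (indicator K y *\<^sub>R v y) $ i = h y)"
    by blast
  from choice[OF this] obtain h where
    h': "\<forall>i. h i \<in> borel_measurable lborel \<and> (AE y in lborel. (indicator K y *\<^sub>R v y) $ i = h i y)" ..
  then have h [measurable]: "h i \<in> borel_measurable borel"
    and ae: "AE y in lborel. (indicator K y *\<^sub>R v y) $ i = h i y" for i by simp_all
  define w where "w y = (\<chi> i. h i y)" for y
  \<comment> \<open>an arbitrary unit vector repairs the null set of \<open>K\<close> on which \<open>w\<close> fails to have length 1\<close>
  define g where "g y = (if y \<in> K then if norm (w y) = 1 then w y else axis undefined 1 else 0)" for y
  have w [measurable]: "w \<in> borel_measurable borel"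
    unfolding w_def[abs_def] by (intro borel_measurable_vec_lambda h)
  have "AE y in lborel. \<forall>i\<in>UNIV. (indicator K y *\<^sub>R v y) $ i = h i y"
    using ae by (intro AE_finite_allI) auto
  then have "AE y in lborel. y \<in> K \<longrightarrow> v y = g y"
    using unit
  proof eventually_elim
    case (elim y)
    then have "y \<in> K \<Longrightarrow> v y = w y" by (simp add: w_def vec_eq_iff)
    then show ?case using elim by (auto simp: g_def)
  qed
  moreover have "g \<in> borel_measurable borel" unfolding g_def[abs_def] by measurable
  moreover have "norm (g y) = 1" if "y \<in> K" for y using that by (simp add: g_def)
  moreover have "g y = 0" if "y \<notin> K" for y using that by (simp add: g_def)
  ultimately show ?thesis by (intro that)
qed

lemma test_function_identity:
  fixes \<psi> \<eta> :: "real^'n \<Rightarrow> real"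
  assumes wg: "weak_gradient \<Omega> \<psi> D\<psi>" and K: "compact K" "K \<subseteq> \<Omega>"
    and eta: "smooth \<eta>" "supp \<eta> \<subseteq> cball 0 1"
    and g [measurable]: "g \<in> borel_measurable borel" and g_off: "\<And>y. y \<notin> K \<Longrightarrow> g y = 0"
    and Dpsi: "AE y in lborel. y \<in> K \<longrightarrow> D\<psi> y = g y"
    and eps: "0 < \<epsilon>" "cball x \<epsilon> \<subseteq> K"
  shows "(LINT y|lebesgue. (indicator K y * \<psi> y) * partial i (\<lambda>y. \<eta> ((1 / \<epsilon>) *\<^sub>R (y - x))) y)
        = - (LINT y|lebesgue. g y $ i * \<eta> ((1 / \<epsilon>) *\<^sub>R (y - x)))"
proof -
  define \<phi> where "\<phi> y = \<eta> ((1 / \<epsilon>) *\<^sub>R (y - x))" for y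
  have smooth: "smooth \<phi>" unfolding \<phi>_def by (intro smooth_affine eta)
  have "{y. \<phi> y \<noteq> 0} \<subseteq> cball x \<epsilon>"
  proof safe
    fix y assume "\<phi> y \<noteq> 0"
    then have "(1 / \<epsilon>) *\<^sub>R (y - x) \<in> cball 0 1"
      using grad_eq_0_off_supp(1)[of "(1 / \<epsilon>) *\<^sub>R (y - x)" \<eta>] eta(2)
      unfolding \<phi>_def by blast
    then show "y \<in> cball x \<epsilon>"
      using eps(1) by (simp only: rescaled_in_unit_cball_iff)
  qed
  then have supp: "supp \<phi> \<subseteq> cball x \<epsilon>" unfolding supp_def by (rule closure_minimal) simp
  then have "bounded (supp \<phi>)" using bounded_cball bounded_subset by blast
  then have "compact (supp \<phi>)" unfolding supp_def by (simp add: compact_eq_bounded_closed)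
  with smooth supp have test: "\<phi> \<in> Cc_inf \<Omega>" using eps K by (auto simp: Cc_inf_def)
  have off: "\<phi> y = 0" "partial i \<phi> y = 0" if "y \<notin> K" for y
    using grad_eq_0_off_supp[of y \<phi>] supp eps that by (auto simp: grad_def vec_eq_iff)
  have "(LINT y|lebesgue. (indicator K y * \<psi> y) * partial i \<phi> y) = (LINT y:\<Omega>|lebesgue. \<psi> y * partial i \<phi> y)"
    unfolding set_lebesgue_integral_def
    using K(2) off(2) by (intro Bochner_Integration.integral_cong refl) (auto simp: indicator_def)
  also have "\<dots> = - (LINT y:\<Omega>|lebesgue. D\<psi> y $ i * \<phi> y)"
    using wg test by (simp add: weak_gradient_def)
  also have "(LINT y:\<Omega>|lebesgue. D\<psi> y $ i * \<phi> y) = (LINT y|lebesgue. (indicator K y *\<^sub>R D\<psi> y) $ i * \<phi> y)"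
    unfolding set_lebesgue_integral_def
    using K(2) off(1) by (intro Bochner_Integration.integral_cong refl) (auto simp: indicator_def)
  also have "\<dots> = (LINT y|lebesgue. g y $ i * \<phi> y)"
  proof (rule integral_cong_AE)
    have [measurable]: "\<phi> \<in> borel_measurable lebesgue" "g \<in> borel_measurable lebesgue"
      using smooth by (auto intro!: measurable_completion borel_measurable_continuous_onI smooth_continuous)
    have [measurable]: "(\<lambda>y. indicator K y *\<^sub>R D\<psi> y) \<in> borel_measurable lebesgue"
      using wg K by (auto simp: weak_gradient_def L1_loc_def set_integrable_def)
    show "(\<lambda>y. (indicator K y *\<^sub>R D\<psi> y) $ i * \<phi> y) \<in> borel_measurable lebesgue"
      "(\<lambda>y. g y $ i * \<phi> y) \<in> borel_measurable lebesgue" by measurable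
    have "AE y in lebesgue. y \<in> K \<longrightarrow> D\<psi> y = g y" using Dpsi by (rule AE_completion)
    then show "AE y in lebesgue. (indicator K y *\<^sub>R D\<psi> y) $ i * \<phi> y = g y $ i * \<phi> y"
      by eventually_elim (auto simp: indicator_def g_off)
  qed
  finally show ?thesis by (simp only: \<phi>_def)
qed

lemma D_const_eq: "D_const \<eta> = hessian_const \<eta> 3 + defect_const \<eta> 3"
proof -
  have sq: "norm z powr 2 = norm z ^ 2" "\<bar>\<eta> z\<bar> powr 3 = \<bar>\<eta> z\<bar> ^ 3" for z
    by simp_all
  have "0 \<le> (LINT z|lebesgue. norm z powr (1 / 2) * norm (grad \<eta> z) powr (3 / 2))"
    by (intro integral_nonneg_AE) auto
  then show ?thesis
    by (simp add: D_const_def hessian_const_def defect_const_def sq)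
qed

context unit_gradient_mollification
begin

lemma energy_mono: "S \<subseteq> T \<Longrightarrow> energy r \<epsilon> S \<le> energy r \<epsilon> T"
  unfolding energy_def by (intro nn_integral_mono) (auto simp: indicator_def)

lemma energy_cong_AE:
  assumes "AE x in lborel. x \<in> S \<longleftrightarrow> x \<in> T"
  shows "energy r \<epsilon> S = energy r \<epsilon> T"
  unfolding energy_def using assms
  by (intro nn_integral_cong_AE) (auto simp: indicator_def elim!: eventually_mono)

end

section \<open>The upper bound\<close>

theorem theorem1p4:
  fixes \<Omega> \<Omega>0 :: "(real^'n) set"
    and \<psi> \<eta> :: "real^'n \<Rightarrow> real"
    and D\<psi> :: "real^'n \<Rightarrow> real^'n"
  assumes "open \<Omega>"
    and "open \<Omega>0" and "compactly_in \<Omega>0 \<Omega>"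
    and "W1_inf_loc \<Omega> \<psi>"
    and "weak_gradient \<Omega> \<psi> D\<psi>"
    and "AE x in lebesgue_on \<Omega>. norm (D\<psi> x) = 1"
    and "\<eta> \<in> Cc_inf UNIV"
    and "\<forall>z. 0 \<le> \<eta> z"
    and "supp \<eta> \<subseteq> cball 0 1"
    and "(LINT z|lebesgue. \<eta> z) = 1"
  shows
    "(\<forall>q p. 1 < q \<longrightarrow> 2 \<le> p \<longrightarrow> BV_loc q \<Omega> D\<psi> \<longrightarrow> BV_loc p \<Omega> D\<psi> \<longrightarrow>
        Limsup (at_right 0) (\<lambda>\<epsilon>. \<integral>\<^sup>+x\<in>\<Omega>0. ennreal
            (\<epsilon> powr (q - 1) * norm (hessian (mollify \<eta> \<psi> \<epsilon>) x) powr q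
             + 1 / \<epsilon> * (1 - (norm (grad (mollify \<eta> \<psi> \<epsilon>) x))\<^sup>2) powr (p / 2)) \<partial>lebesgue)
        \<le> ennreal (hessian_const \<eta> q) * A_lim q D\<psi> (closure \<Omega>0)
           + ennreal (defect_const \<eta> p) * A_lim p D\<psi> (closure \<Omega>0))
     \<and>
     (BV_loc 3 \<Omega> D\<psi> \<longrightarrow>
        (let L1 = Limsup (at_right 0) (\<lambda>\<epsilon>. \<integral>\<^sup>+x\<in>\<Omega>0. ennreal
                (norm (hessian (mollify \<eta> \<psi> \<epsilon>) x)
                 * \<bar>1 - (norm (grad (mollify \<eta> \<psi> \<epsilon>) x))\<^sup>2\<bar>) \<partial>lebesgue);
             L2 = Limsup (at_right 0) (\<lambda>\<epsilon>.
                (\<integral>\<^sup>+x\<in>\<Omega>0. ennreal (\<epsilon>\<^sup>2 * norm (hessian (mollify \<eta> \<psi> \<epsilon>) x) ^ 3) \<partial>lebesgue)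
                + (\<integral>\<^sup>+x\<in>\<Omega>0. ennreal (1 / \<epsilon> *
                     (1 - (norm (grad (mollify \<eta> \<psi> \<epsilon>) x))\<^sup>2) powr (3 / 2)) \<partial>lebesgue))
         in ennreal (3 / root 3 4) * L1 \<le> L2
          \<and> L2 \<le> ennreal (D_const \<eta>) * A_lim 3 D\<psi> (closure \<Omega>0)
          \<and> ennreal (D_const \<eta>) * A_lim 3 D\<psi> (closure \<Omega>0)
              = ennreal (D_const \<eta>) * A3_shift D\<psi> (closure \<Omega>0)
          \<and> L2 \<le> ennreal (D_const \<eta>) * A3_shift D\<psi> \<Omega>0
          \<and> (negligible (frontier \<Omega>0) \<longrightarrow>
               ennreal (D_const \<eta>) * A_lim 3 D\<psi> (closure \<Omega>0)
                 = ennreal (D_const \<eta>) * A3_shift D\<psi> \<Omega>0)))"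
proof -
  have cl: "compact (closure \<Omega>0)" "closure \<Omega>0 \<subseteq> \<Omega>"
    using assms(3) by (auto simp: compactly_in_def)
  obtain d where d: "0 < d" "(\<Union>x\<in>closure \<Omega>0. cball x d) \<subseteq> \<Omega>"
    using compact_subset_open_imp_cball_epsilon_subset[OF cl(1) assms(1) cl(2)] by metis
  \<comment> \<open>the collar \<open>V\<close> has half the width of \<open>K\<close>, so that balls of radius below \<open>d / 2\<close> about its
    points stay in \<open>K\<close>\<close>
  define K where "K = {x + y | x y. x \<in> closure \<Omega>0 \<and> y \<in> cball 0 d}"
  define V where "V = (\<Union>x\<in>closure \<Omega>0. ball x (d / 2))"
  have K: "compact K" unfolding K_def by (intro compact_sums cl) simp
  have K_cball: "cball x d \<subseteq> K" if "x \<in> closure \<Omega>0" for x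
  proof
    fix y assume "y \<in> cball x d"
    then show "y \<in> K" using that unfolding K_def
      by (intro CollectI exI[of _ x] exI[of _ "y - x"]) (auto simp: dist_norm norm_minus_commute)
  qed
  have "K \<subseteq> \<Omega>"
  proof
    fix y assume "y \<in> K"
    then obtain a b where "y = a + b" "a \<in> closure \<Omega>0" "b \<in> cball 0 d" by (auto simp: K_def)
    then have "y \<in> cball a d" "a \<in> closure \<Omega>0" by (auto simp: dist_norm)
    then show "y \<in> \<Omega>" using d(2) by blast
  qed
  have "open V" by (auto simp: V_def)
  have V_sub: "closure \<Omega>0 \<subseteq> V" using d(1) by (force simp: V_def)
  then have \<Omega>0_V: "\<Omega>0 \<subseteq> V" using closure_subset by blast
  have V_cball: "cball x \<epsilon> \<subseteq> K" if "x \<in> V" "\<epsilon> < d / 2" for x \<epsilon>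
  proof -
    obtain a where a: "a \<in> closure \<Omega>0" "dist a x < d / 2" using \<open>x \<in> V\<close> by (auto simp: V_def)
    have "cball x \<epsilon> \<subseteq> cball a d"
    proof
      fix y assume "y \<in> cball x \<epsilon>"
      then show "y \<in> cball a d" using a(2) that(2) dist_triangle[of a y x] by simp
    qed
    then show ?thesis using K_cball[OF a(1)] by blast
  qed
  have L1: "D\<psi> absolutely_integrable_on K" "\<psi> absolutely_integrable_on K"
    using assms(5) K \<open>K \<subseteq> \<Omega>\<close> by (auto simp: weak_gradient_def L1_loc_def)
  have unit: "AE y in lborel. y \<in> K \<longrightarrow> norm (D\<psi> y) = 1"
  proof -
    have "AE y in lebesgue. y \<in> \<Omega> \<longrightarrow> norm (D\<psi> y) = 1"
      using assms(1,6) by (subst (asm) AE_restrict_space_iff) (auto simp: borel_open)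
    then show ?thesis unfolding AE_completion_iff
      by eventually_elim (use \<open>K \<subseteq> \<Omega>\<close> in auto)
  qed
  obtain g where g: "g \<in> borel_measurable borel" "\<And>y. y \<in> K \<Longrightarrow> norm (g y) = 1" "\<And>y. y \<notin> K \<Longrightarrow> g y = 0"
    and Dpsi: "AE y in lborel. y \<in> K \<longrightarrow> D\<psi> y = g y"
    by (rule borel_unit_representative[OF L1(1) K unit]) (rule that)
  have smooth: "smooth \<eta>" using assms(7) by (simp add: Cc_inf_def)
  have "\<eta> \<in> borel_measurable lborel"
    using smooth by (simp add: borel_measurable_continuous_onI smooth_continuous)
  then have int_eta: "(LINT z|lborel. \<eta> z) = 1"
    using assms(10) integral_completion[of \<eta> lborel] by simp
  interpret unit_gradient_mollification \<eta> \<psi> g K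
  proof (intro unit_gradient_mollification.intro kernel.intro unit_gradient_mollification_axioms.intro)
    show "smooth \<eta>" by (rule smooth)
    show "supp \<eta> \<subseteq> cball 0 1" by (rule assms(9))
    show "\<And>z. 0 \<le> \<eta> z" using assms(8) by blast
    show "integrable lebesgue (\<lambda>y. indicator K y * \<psi> y)" using L1(2) by (simp add: set_integrable_def)
    show "(LINT y|lebesgue. (indicator K y * \<psi> y) * partial i (\<lambda>y. \<eta> ((1 / \<epsilon>) *\<^sub>R (y - x))) y)
        = - (LINT y|lebesgue. g y $ i * \<eta> ((1 / \<epsilon>) *\<^sub>R (y - x)))"
      if "0 < \<epsilon>" "cball x \<epsilon> \<subseteq> K" for x \<epsilon> i
      using that
      by (intro test_function_identity[OF assms(5) K \<open>K \<subseteq> \<Omega>\<close> smooth assms(9) g(1,3) Dpsi])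
  qed (rule int_eta g(1) K | erule g(2) g(3))+
  have small: "\<forall>\<^sub>F \<epsilon> in at_right 0. P \<epsilon>"
    if "\<And>\<epsilon>. 0 < \<epsilon> \<Longrightarrow> (\<And>x. x \<in> V \<Longrightarrow> cball x \<epsilon> \<subseteq> K) \<Longrightarrow> P \<epsilon>" for P :: "real \<Rightarrow> bool"
    using d(1) that V_cball by (intro eventually_at_rightI[of 0 "d / 2"]) auto
  have S_borel: "\<Omega>0 \<in> sets borel" "closure \<Omega>0 \<in> sets borel" using assms(2) by auto
  define E where "E r S = Limsup (at_right 0) (\<lambda>\<epsilon>. energy r \<epsilon> S)" for r S
  have A_lim: "A_lim r D\<psi> (closure \<Omega>0) = E r (closure \<Omega>0)" for r
    unfolding A_lim_def E_def
    by (intro Limsup_eq small energy_eq_difference_quotient[OF _ \<open>open V\<close> _ S_borel(2) V_sub Dpsi])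
  have A3: "A3_shift D\<psi> S = E 3 S" if "S = \<Omega>0 \<or> S = closure \<Omega>0" for S
    unfolding A3_shift_def E_def
    using that S_borel V_sub \<Omega>0_V
    by (intro Limsup_eq small energy_eq_shift[OF _ \<open>open V\<close> _ _ _ Dpsi]) auto
  have E_mono: "E r \<Omega>0 \<le> E r (closure \<Omega>0)" for r
    unfolding E_def by (intro Limsup_mono always_eventually allI energy_mono closure_subset)
  define T where "T q p \<epsilon> = (\<integral>\<^sup>+x\<in>\<Omega>0. ennreal
            (\<epsilon> powr (q - 1) * norm (hessian (mollify \<eta> \<psi> \<epsilon>) x) powr q
             + 1 / \<epsilon> * (1 - (norm (grad (mollify \<eta> \<psi> \<epsilon>) x))\<^sup>2) powr (p / 2)) \<partial>lebesgue)" for q p \<epsilon>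
  have T_bound: "Limsup (at_right 0) (T q p)
      \<le> ennreal (hessian_const \<eta> q) * E q \<Omega>0 + ennreal (defect_const \<eta> p) * E p \<Omega>0"
    if "1 < q" "2 \<le> p" for q p
  proof -
    have "Limsup (at_right 0) (T q p) \<le> Limsup (at_right 0)
        (\<lambda>\<epsilon>. ennreal (hessian_const \<eta> q) * energy q \<epsilon> \<Omega>0 + ennreal (defect_const \<eta> p) * energy p \<epsilon> \<Omega>0)"
      unfolding T_def
      by (intro Limsup_mono small total_bound[OF _ \<open>open V\<close> _ S_borel(1) \<Omega>0_V that])
    also have "\<dots> \<le> Limsup (at_right 0) (\<lambda>\<epsilon>. ennreal (hessian_const \<eta> q) * energy q \<epsilon> \<Omega>0)
        + Limsup (at_right 0) (\<lambda>\<epsilon>. ennreal (defect_const \<eta> p) * energy p \<epsilon> \<Omega>0)"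
      by (rule Limsup_add_le_ennreal)
    finally show ?thesis by (simp add: Limsup_cmult_ennreal E_def)
  qed
  define L2 where "L2 = Limsup (at_right 0) (\<lambda>\<epsilon>.
                (\<integral>\<^sup>+x\<in>\<Omega>0. ennreal (\<epsilon>\<^sup>2 * norm (hessian (mollify \<eta> \<psi> \<epsilon>) x) ^ 3) \<partial>lebesgue)
                + (\<integral>\<^sup>+x\<in>\<Omega>0. ennreal (1 / \<epsilon> *
                     (1 - (norm (grad (mollify \<eta> \<psi> \<epsilon>) x))\<^sup>2) powr (3 / 2)) \<partial>lebesgue))"
  have L2: "L2 = Limsup (at_right 0) (T 3 3)"
    unfolding L2_def
  proof (intro Limsup_eq small)
    fix \<epsilon> :: real assume eps: "0 < \<epsilon>" "\<And>x. x \<in> V \<Longrightarrow> cball x \<epsilon> \<subseteq> K"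
    have "T 3 3 \<epsilon> = (\<integral>\<^sup>+x\<in>\<Omega>0. ennreal (\<epsilon> powr (3 - 1) * norm (hessian (mollify \<eta> \<psi> \<epsilon>) x) powr 3) \<partial>lebesgue)
        + (\<integral>\<^sup>+x\<in>\<Omega>0. ennreal (1 / \<epsilon> *
             (1 - (norm (grad (mollify \<eta> \<psi> \<epsilon>) x))\<^sup>2) powr (3 / 2)) \<partial>lebesgue)"
      unfolding T_def by (intro integral_of_sum[OF eps(1) \<open>open V\<close> _ S_borel(1) \<Omega>0_V] eps(2))
    then show "(\<integral>\<^sup>+x\<in>\<Omega>0. ennreal (\<epsilon>\<^sup>2 * norm (hessian (mollify \<eta> \<psi> \<epsilon>) x) ^ 3) \<partial>lebesgue)
        + (\<integral>\<^sup>+x\<in>\<Omega>0. ennreal (1 / \<epsilon> *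
             (1 - (norm (grad (mollify \<eta> \<psi> \<epsilon>) x))\<^sup>2) powr (3 / 2)) \<partial>lebesgue) = T 3 3 \<epsilon>"
      using eps(1) by simp
  qed
  have L2_bound: "L2 \<le> ennreal (D_const \<eta>) * E 3 \<Omega>0"
    using T_bound[of 3 3]
    by (simp add: L2 D_const_eq hessian_const_def defect_const_def ennreal_plus distrib_right)
  show ?thesis
    unfolding Let_def L2_def[symmetric]
  proof (intro conjI allI impI)
    fix q p :: real assume qp: "1 < q" "2 \<le> p"
    have "Limsup (at_right 0) (T q p)
      \<le> ennreal (hessian_const \<eta> q) * E q (closure \<Omega>0) + ennreal (defect_const \<eta> p) * E p (closure \<Omega>0)"
      by (rule order_trans[OF T_bound[OF qp]]) (intro add_mono mult_left_mono E_mono; simp)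
    then show "Limsup (at_right 0) (\<lambda>\<epsilon>. \<integral>\<^sup>+x\<in>\<Omega>0. ennreal
            (\<epsilon> powr (q - 1) * norm (hessian (mollify \<eta> \<psi> \<epsilon>) x) powr q
             + 1 / \<epsilon> * (1 - (norm (grad (mollify \<eta> \<psi> \<epsilon>) x))\<^sup>2) powr (p / 2)) \<partial>lebesgue)
        \<le> ennreal (hessian_const \<eta> q) * A_lim q D\<psi> (closure \<Omega>0)
           + ennreal (defect_const \<eta> p) * A_lim p D\<psi> (closure \<Omega>0)"
      unfolding A_lim T_def .
  next
    show "ennreal (3 / root 3 4) * Limsup (at_right 0) (\<lambda>\<epsilon>. \<integral>\<^sup>+x\<in>\<Omega>0. ennreal
                (norm (hessian (mollify \<eta> \<psi> \<epsilon>) x)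
                 * \<bar>1 - (norm (grad (mollify \<eta> \<psi> \<epsilon>) x))\<^sup>2\<bar>) \<partial>lebesgue) \<le> L2"
      unfolding L2 T_def Limsup_cmult_ennreal[OF trivial_limit_at_right_real, symmetric]
      by (intro Limsup_mono small product_bound[OF _ \<open>open V\<close> _ S_borel(1) \<Omega>0_V])
  next
    show "L2 \<le> ennreal (D_const \<eta>) * A_lim 3 D\<psi> (closure \<Omega>0)"
      unfolding A_lim by (rule order_trans[OF L2_bound]) (intro mult_left_mono E_mono; simp)
  next
    show "ennreal (D_const \<eta>) * A_lim 3 D\<psi> (closure \<Omega>0) = ennreal (D_const \<eta>) * A3_shift D\<psi> (closure \<Omega>0)"
      by (simp add: A_lim A3)
  next
    show "L2 \<le> ennreal (D_const \<eta>) * A3_shift D\<psi> \<Omega>0"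
      using L2_bound by (simp add: A3)
  next
    assume "negligible (frontier \<Omega>0)"
    then have "AE x in lebesgue. x \<notin> frontier \<Omega>0"
      by (intro AE_not_in) (simp add: negligible_iff_null_sets)
    then have "AE x in lborel. x \<notin> frontier \<Omega>0"
      by (simp only: AE_completion_iff)
    then have "AE x in lborel. x \<in> closure \<Omega>0 \<longleftrightarrow> x \<in> \<Omega>0"
      by eventually_elim (use closure_subset in \<open>auto simp: frontier_def interior_open[OF assms(2)]\<close>)
    then show "ennreal (D_const \<eta>) * A_lim 3 D\<psi> (closure \<Omega>0) = ennreal (D_const \<eta>) * A3_shift D\<psi> \<Omega>0"
      by (simp add: A_lim A3 E_def energy_cong_AE)
  qed
qed

end
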